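(* Let $(\mathfrak{M},d)$ be a complete metric space, $1<p<\infty$, $\mathcal{E}:\mathfrak{M}\to(-\infty,+\infty]$ a proper functional with strong upper gradient $g$, and $\varphi\in\mathfrak{M}$ an equilibrium point, i.e. $g(\varphi)=0$. Suppose $\mathcal{E}$ satisfies a Kurdyka–Łojasiewicz inequality on a set $\mathcal{U}$, i.e. there is a strictly increasing $\theta\in W^{1,1}_{loc}(\mathbb{R})$ with $\theta(0)=0$ such that $\mathcal{U}\subseteq\{v: g(v)>0\}\cap\{v:\theta'(\mathcal{E}(v|\varphi))>0\}$ and $$\theta'(\mathcal{E}(v|\varphi))\,g(v)\ge 1\qquad\text{for all } v\in\mathcal{U}.$$ Then the following statements hold. (1) Let $v:[0,T)\to\mathfrak{M}$, $0<T\le+\infty$, be a piecewise $p$-gradient flow of $\mathcal{E}$, and suppose there is $0\le t_0<T$ such that $v(t)\in\mathcal{U}$ for almost every $t\in[t_0,T)$ and $\mathcal{E}\circ v_{|[t_0,T)}$ is bounded from below. Then the curve $v_{|[t_0,T)}$ has finite length $\int_{t_0}^{T}|v'|(r)\,dr$. (2) There is a strictly increasing function $\theta\in W^{1,1}_{loc}(\mathbb{R})$ with $\theta(0)=0$ such that for every $p$-gradient flow $v:[0,T)\to\mathfrak{M}$ of $\mathcal{E}$ satisfying $v(t)\in\mathcal{U}$ for almost every $t\in[t_0,T)$, for some $0\le t_0<T\le+\infty$, one has $$d(v(s),v(t))\le\int_s^t|v'|(r)\,dr\le\theta(\mathcal{E}(v(s)|\varphi))-\theta(\mathcal{E}(v(t)|\varphi))\qquad\text{for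 every } t_0\le s<t<T .$$
   Context: $p'=p/(p-1)$. $D(\mathcal{E})=\{\mathcal{E}<+\infty\}$; proper means $D(\mathcal{E})\neq\emptyset$. $\mathcal{E}(v|\varphi):=\mathcal{E}(v)-\mathcal{E}(\varphi)$. $AC(a,b;\mathfrak{M})$ (resp. $AC_{loc}(a,b;\mathfrak{M})$) is the set of curves $v:(a,b)\to\mathfrak{M}$ for which there is $m\in L^1(a,b)$ (resp. $L^1_{loc}(a,b)$) with $d(v(s),v(t))\le\int_s^t m(r)\,dr$ for all $a<s\le t<b$; $AC_{loc}((0,b];\mathfrak{M})$ means $m\in L^1_{loc}((0,b])$. The metric derivative $|v'|(t)=\lim_{s\to t}d(v(s),v(t))/|s-t|$ exists a.e. and is the smallest such $m$. A proper $g:\mathfrak{M}\to[0,+\infty]$ with $\{g<\infty\}\subseteq D(\mathcal{E})$ is a strong upper gradient of $\mathcal{E}$ if for every $v\in AC(a,b;\mathfrak{M})$, $g\circ v$ is Borel and $|\mathcal{E}(v(t))-\mathcal{E}(v(s))|\le\int_s^t g(v(r))|v'|(r)\,dr$ for all $a<s\le t<b$ (the integral may be $+\infty$). A curve $v:[0,T)\to\mathfrak{M}$ is a $p$-gradient flow of $\mathcal{E}$ (w.r.t. $g$) if $v\in AC_{loc}(0,T;\mathfrak{M})$, $\mathcal{E}\circ v:(0,T)\to\mathbb{R}$ is non-increasing and $\frac{d}{dt}\mathcal{E}(v(t))\le-\frac1{p'}g^{p'}(v(t))-\frac1p|v'|^p(t)$ for a.e. $t\in(0,T)$. A curve $v:[0,T)\to\mathfrak{M}$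 is a piecewise $p$-gradient flow of $\mathcal{E}$ if there is a countable partition $\{0=t_0,t_1,t_2,\dots\}$ of $[0,T)$ such that: (i) $v_1:=v_{|(0,t_1]}\in AC_{loc}((0,t_1];\mathfrak{M})$ and $v_1$ is a $p$-gradient flow of $\mathcal{E}$ on $(0,t_1)$; (ii) for every $i\ge2$, $v_{|[t_{i-1},t_i]}\in AC(t_{i-1},t_i;\mathfrak{M})$ and $v_i(t):=v(t_{i-1}+t)$, $t\in[0,t_i-t_{i-1}]$, is a $p$-gradient flow of $\mathcal{E}$ on $(0,t_i-t_{i-1})$; (iii) for all $i\neq j$, the two intervals that are the images under $\mathcal{E}$ of $v_i([0,t_i-t_{i-1}])$ and $v_j([0,t_j-t_{j-1}])$ have at most one common point (for index $1$ the set $v_1((0,t_1])$ is used). Such a $v$ need not be continuous at the points $t_i$; $|v'|$ is defined a.e. piece by piece. Elements of $W^{1,1}_{loc}(\mathbb{R})$ are identified with their continuous representatives; $\theta'$ is the a.e. derivative.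
   Formalization: In (1) the energy along v is also assumed bounded above on (t0,T), as it may jump up or blow up at 0; in (2), s=0 is covered only if v(t)→v(0) as t→0+, E(v(0))<∞ and E(v(r))≤E(v(0)) for all r in (0,T), since a flow leaves v(0) free. Without these the claims fail. *)

theory Defs
  imports "HOL-Analysis.Analysis"
begin

text \<open>
  The metric space is a type of class complete_space (or metric_space), the energy has type
  'a => ereal, upper gradients have type 'a => ennreal. A curve on an interval is a total function
  on the reals of which only the values on that interval are used. Endpoints of
  intervals that may be infinite are extended reals.
\<close>

definition eff_dom :: "('a \<Rightarrow> ereal) \<Rightarrow> 'a set" where
  "eff_dom E = {v. E v < \<infinity>}"

definition proper_energy :: "('a \<Rightarrow> ereal) \<Rightarrow> bool" where
  "proper_energy E \<longleftrightarrow> (\<forall>v. E v \<noteq> -\<infinity>) \<and> eff_dom E \<noteq> {}"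

definition rel_energy :: "('a \<Rightarrow> ereal) \<Rightarrow> 'a \<Rightarrow> 'a \<Rightarrow> ereal" where
  "rel_energy E \<phi> v = E v - E \<phi>"

definition L1_loc :: "real set \<Rightarrow> (real \<Rightarrow> real) \<Rightarrow> bool" where
  "L1_loc J m \<longleftrightarrow> (\<forall>a b. {a..b} \<subseteq> J \<longrightarrow> set_integrable lborel {a..b} m)"

definition AC :: "ereal \<Rightarrow> ereal \<Rightarrow> (real \<Rightarrow> 'a::metric_space) \<Rightarrow> bool" where
  "AC a b v \<longleftrightarrow> (\<exists>m. set_integrable lborel (einterval a b) m \<and>
     (\<forall>s t. a < ereal s \<and> s \<le> t \<and> ereal t < b \<longrightarrow> dist (v s) (v t) \<le> (LBINT r:{s..t}. m r)))"

text \<open>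
  \<open>AC_loc J\<close> covers all the local classes: on an open interval it is \<open>AC_loc(a,b)\<close>, on
  \<open>(0,b]\<close> it is \<open>AC_loc((0,b])\<close>, and on a compact interval \<open>[a,b]\<close> local integrability is
  integrability, so that it agrees with \<open>AC(a,b)\<close>. As in \<open>AC\<close>, the value of the curve at an
  endpoint of \<open>J\<close> is not constrained; a point of \<open>J\<close> at its boundary only affects the
  integrability of \<open>m\<close>.
\<close>

definition AC_loc :: "real set \<Rightarrow> (real \<Rightarrow> 'a::metric_space) \<Rightarrow> bool" where
  "AC_loc J v \<longleftrightarrow> (\<exists>m. L1_loc J m \<and>
     (\<forall>s\<in>interior J. \<forall>t\<in>interior J. s \<le> t \<longrightarrow> dist (v s) (v t) \<le> (LBINT r:{s..t}. m r)))"

text \<open>The value is unspecified at the (for AC curves: null) set of points without a limit.\<close>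

definition metric_deriv :: "(real \<Rightarrow> 'a::metric_space) \<Rightarrow> real \<Rightarrow> real" where
  "metric_deriv v t = Lim (at t) (\<lambda>s. dist (v s) (v t) / \<bar>s - t\<bar>)"

definition curve_length :: "ereal \<Rightarrow> ereal \<Rightarrow> (real \<Rightarrow> 'a::metric_space) \<Rightarrow> ennreal" where
  "curve_length a b v = (\<integral>\<^sup>+r\<in>einterval a b. ennreal (metric_deriv v r) \<partial>lborel)"

text \<open>
  On \<open>ereal\<close> one has \<open>\<infinity> - \<infinity> = \<infinity>\<close>. When the energy is infinite at both \<open>v s\<close> and \<open>v t\<close> the
  difference is taken to vanish; otherwise a curve that is constant at a point of infinite
  energy would violate the inequality.
\<close>

definition strong_upper_gradient :: "('a::metric_space \<Rightarrow> ereal) \<Rightarrow> ('a \<Rightarrow> ennreal) \<Rightarrow> bool" where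
  "strong_upper_gradient E g \<longleftrightarrow>
     {v. g v < \<infinity>} \<noteq> {} \<and> {v. g v < \<infinity>} \<subseteq> eff_dom E \<and>
     (\<forall>a b v. a < b \<and> AC a b v \<longrightarrow>
        (\<lambda>r. g (v r)) \<in> borel_measurable (restrict_space borel (einterval a b)) \<and>
        (\<forall>s t. a < ereal s \<and> s \<le> t \<and> ereal t < b \<longrightarrow>
           (E (v s) = \<infinity> \<and> E (v t) = \<infinity>) \<or>
           \<bar>E (v t) - E (v s)\<bar>
             \<le> enn2ereal (\<integral>\<^sup>+r\<in>{s..t}. (g (v r) * ennreal (metric_deriv v r)) \<partial>lborel)))"

text \<open>
  The right-hand side of the dissipation inequality is \<open>-\<infinity>\<close> where \<open>g\<close> is infinite, hence the
  requirement that \<open>g (v t)\<close> is finite for almost every \<open>t\<close>. Only the values of \<open>v\<close> on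
  the open interval \<open>(0,T)\<close> enter.
\<close>

definition p_gradient_flow ::
    "real \<Rightarrow> ('a::metric_space \<Rightarrow> ereal) \<Rightarrow> ('a \<Rightarrow> ennreal) \<Rightarrow> ereal \<Rightarrow> (real \<Rightarrow> 'a) \<Rightarrow> bool" where
  "p_gradient_flow p E g T v \<longleftrightarrow>
     AC_loc (einterval 0 T) v \<and>
     (\<forall>t\<in>einterval 0 T. \<bar>E (v t)\<bar> \<noteq> \<infinity>) \<and>
     (\<forall>s\<in>einterval 0 T. \<forall>t\<in>einterval 0 T. s \<le> t \<longrightarrow> E (v t) \<le> E (v s)) \<and>
     (let p' = p / (p - 1) in
      AE t in lborel. t \<in> einterval 0 T \<longrightarrow>
        g (v t) < \<infinity> \<and>
        (\<exists>D. ((\<lambda>r. real_of_ereal (E (v r))) has_real_derivative D) (at t) \<and>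
             D \<le> - (1 / p') * enn2real (g (v t)) powr p' - (1 / p) * metric_deriv v t powr p))"

text \<open>
  The points \<open>t 0 = 0 < t 1 < t 2 < \<dots>\<close> of a countable partition of \<open>[0,T)\<close>; a finite
  partition is represented by a sequence that becomes stationary on reaching \<open>T\<close>.
\<close>

definition time_partition :: "ereal \<Rightarrow> (nat \<Rightarrow> ereal) \<Rightarrow> bool" where
  "time_partition T t \<longleftrightarrow>
     t 0 = 0 \<and> mono t \<and> (\<forall>i. t i < T \<longrightarrow> t i < t (Suc i)) \<and> (SUP i. t i) = T"

text \<open>
  The interval \<open>[t i, t (Suc i)]\<close> of the \<open>(i+1)\<close>-st piece, without the point \<open>0\<close> for the first
  piece, and without \<open>T\<close> (where the curve is not defined) for the last one, if there is a last.
\<close>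

definition piece :: "ereal \<Rightarrow> (nat \<Rightarrow> ereal) \<Rightarrow> nat \<Rightarrow> real set" where
  "piece T t i = {r. 0 < r \<and> t i \<le> ereal r \<and> ereal r \<le> t (Suc i) \<and> ereal r < T}"

definition piecewise_p_gradient_flow ::
    "real \<Rightarrow> ('a::metric_space \<Rightarrow> ereal) \<Rightarrow> ('a \<Rightarrow> ennreal) \<Rightarrow> ereal \<Rightarrow> (real \<Rightarrow> 'a) \<Rightarrow> bool" where
  "piecewise_p_gradient_flow p E g T v \<longleftrightarrow>
     (\<exists>t. time_partition T t \<and>
        (\<forall>i. t i < T \<longrightarrow>
           AC_loc (piece T t i) v \<and>
           p_gradient_flow p E g (t (Suc i) - t i) (\<lambda>r. v (real_of_ereal (t i) + r))) \<and>
        (\<forall>i j. i \<noteq> j \<and> t i < T \<and> t j < T \<longrightarrow>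
           (\<forall>x y. {x, y} \<subseteq> (E \<circ> v) ` piece T t i \<inter> (E \<circ> v) ` piece T t j \<longrightarrow> x = y)))"

text \<open>Weak derivatives on the real line, tested with \<open>C\<^sup>1\<close> functions of compact support.\<close>

definition weak_deriv :: "(real \<Rightarrow> real) \<Rightarrow> (real \<Rightarrow> real) \<Rightarrow> bool" where
  "weak_deriv \<theta> f \<longleftrightarrow>
     (\<forall>\<psi> \<psi>'. (\<forall>x. (\<psi> has_real_derivative \<psi>' x) (at x)) \<and> continuous_on UNIV \<psi>' \<and>
        (\<exists>R. \<forall>x. \<bar>x\<bar> > R \<longrightarrow> \<psi> x = 0) \<longrightarrow>
        (LBINT x. \<theta> x * \<psi>' x) = - (LBINT x. f x * \<psi> x))"

text \<open>Continuous representatives of the elements of the local Sobolev space \<open>W\<^sup>1\<^sup>,\<^sup>1\<close> of the line.\<close>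

definition W11_loc :: "(real \<Rightarrow> real) \<Rightarrow> bool" where
  "W11_loc \<theta> \<longleftrightarrow>
     continuous_on UNIV \<theta> \<and> L1_loc UNIV \<theta> \<and> (\<exists>f. L1_loc UNIV f \<and> weak_deriv \<theta> f)"

text \<open>
  The derivative of \<open>\<theta>\<close> exists almost everywhere only. A point \<open>v\<close> belongs to the set where the
  derivative at the relative energy of \<open>v\<close> is positive if that energy is finite and \<open>\<theta>\<close>
  is differentiable there with positive derivative.
\<close>

definition KL_inequality ::
    "('a \<Rightarrow> ereal) \<Rightarrow> ('a \<Rightarrow> ennreal) \<Rightarrow> 'a \<Rightarrow> 'a set \<Rightarrow> bool" where
  "KL_inequality E g \<phi> U \<longleftrightarrow>
     (\<exists>\<theta>. strict_mono \<theta> \<and> W11_loc \<theta> \<and> \<theta> 0 = 0 \<and>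
        U \<subseteq> {v. g v > 0} \<inter>
            {v \<in> eff_dom E. \<theta> differentiable (at (real_of_ereal (rel_energy E \<phi> v))) \<and>
                            deriv \<theta> (real_of_ereal (rel_energy E \<phi> v)) > 0} \<and>
        (\<forall>v\<in>U. ennreal (deriv \<theta> (real_of_ereal (rel_energy E \<phi> v))) * g v \<ge> 1))"

text \<open>
  A flow does not restrict the value \<open>v 0\<close>. The following says that it starts at \<open>v 0\<close>, with
  finite initial energy which is not exceeded later.
\<close>

definition starts_regularly :: "('a::metric_space \<Rightarrow> ereal) \<Rightarrow> ereal \<Rightarrow> (real \<Rightarrow> 'a) \<Rightarrow> bool" where
  "starts_regularly E T v \<longleftrightarrow>
     (v \<longlongrightarrow> v 0) (at_right 0) \<and> E (v 0) < \<infinity> \<and> (\<forall>r\<in>einterval 0 T. E (v r) \<le> E (v 0))"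

end

theory Submission
  imports Defs
begin

text \<open>
  Along a flow \<open>v\<close>, the function \<open>f = \<theta>(E(v|\<phi>))\<close> is non-increasing and almost everywhere
  differentiable, and the chain rule, Young's inequality and the Kurdyka-Lojasiewicz inequality
  give \<open>|v'| \<le> \<theta>'(E(v|\<phi>)) g(v) |v'| \<le> -f'\<close>. For a monotone \<open>f\<close> the integral of \<open>-f'\<close> over
  \<open>[s,t]\<close> is at most \<open>f s - f t\<close> by Fatou's lemma, so that neither the absolute continuity of
  \<open>f\<close> nor that of \<open>\<theta>\<close> is used. The bound for the distance is the existence of
  the metric derivative as a density of the length.

  For a piecewise flow, the strong upper gradient property makes the energy continuous on each piece.
  The open sets \<open>S i\<close> of values strictly between two values of \<open>f\<close> on the \<open>i\<close>-th piece are therefore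
  contained in the images of the pieces, hence pairwise disjoint; the length of a piece is
  at most the measure of \<open>S i\<close>, and all \<open>S i\<close> lie in one bounded interval.
\<close>

section \<open>Differentiation of integrals and the metric derivative\<close>

lemma set_integrable_of_integrable:
  fixes w :: "real \<Rightarrow> real"
  assumes "integrable lborel w" "A \<in> sets lborel"
  shows "set_integrable lborel A w"
  using integrable_mult_indicator[OF assms(2,1)] by (simp add: set_integrable_def)

lemma integral_has_right_derivative:
  fixes f g :: "real \<Rightarrow> real"
  assumes g: "integrable lborel g"
    and fg: "\<And>x y. x \<le> y \<Longrightarrow> f y - f x = (LBINT r:{x..y}. g r)"
  obtains N where "negligible N" "\<And>x. x \<notin> N \<Longrightarrow> (f has_real_derivative g x) (at_right x)"
proof -
  note si = set_integrable_of_integrable[OF g]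
  have int: "g integrable_on cbox a b" for a b
    using set_borel_integral_eq_integral(1)[OF si] by auto
  obtain N where N: "negligible N"
    "\<And>x e. \<lbrakk>x \<notin> N; 0 < e\<rbrakk> \<Longrightarrow> \<exists>d>0. \<forall>h. 0 < h \<and> h < d \<longrightarrow>
        norm (integral (cbox x (x + h *\<^sub>R One)) g /\<^sub>R h ^ DIM(real) - g x) < e"
    using integrable_ccontinuous_explicit[OF int] by blast
  have eq: "integral {x..y} g = f y - f x" if "x \<le> y" for x y
    using set_borel_integral_eq_integral(2)[OF si, of "{x..y}"] fg[OF that] by simp
  have "(f has_real_derivative g x) (at_right x)" if "x \<notin> N" for x
    unfolding has_field_derivative_iff
  proof (rule tendstoI)
    fix e :: real assume "e > 0"
    from N(2)[OF that this] obtain d where d: "d > 0"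
      "\<And>h. 0 < h \<and> h < d \<Longrightarrow> norm (integral {x..x + h} g / h - g x) < e"
      by (auto simp: divide_inverse mult.commute)
    show "\<forall>\<^sub>F y in at_right x. dist ((f y - f x) / (y - x)) (g x) < e"
      unfolding eventually_at_right_field
    proof (intro exI[of _ "x + d"] conjI allI impI)
      fix y assume "x < y" "y < x + d"
      then show "dist ((f y - f x) / (y - x)) (g x) < e"
        using d(2)[of "y - x"] eq[of x y] by (simp add: dist_norm)
    qed (use d in simp)
  qed
  with N(1) show ?thesis using that by blast
qed

text \<open>The left derivative comes from the right one by reflection:
  \<open>\<lambda>x. - f (- x)\<close> is a primitive of \<open>\<lambda>x. g (- x)\<close>, and its
  right derivative at \<open>- x\<close> is the left derivative of \<open>f\<close> at
  \<open>x\<close>. The exceptional set is \<open>N\<close> together with the reflection of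
  \<open>N'\<close>.\<close>

lemma integral_has_derivative_AE:
  fixes f g :: "real \<Rightarrow> real"
  assumes g: "integrable lborel g"
    and fg: "\<And>x y. x \<le> y \<Longrightarrow> f y - f x = (LBINT r:{x..y}. g r)"
  shows "AE x in lborel. (f has_real_derivative g x) (at x)"
proof -
  obtain N where N: "negligible N" "\<And>x. x \<notin> N \<Longrightarrow> (f has_real_derivative g x) (at_right x)"
    using integral_has_right_derivative[OF assms] by blast
  have g': "integrable lborel (\<lambda>x. g (- x))"
    using lborel_integrable_real_affine[OF g, of "-1" 0] by simp
  have fg': "- f (- y) - - f (- x) = (LBINT r:{x..y}. g (- r))" if "x \<le> y" for x y
  proof -
    have "(LBINT r:{x..y}. g (- r)) = (LBINT r:{-y..-x}. g r)"
      unfolding set_lebesgue_integral_def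
      by (subst (2) lborel_integral_real_affine[of "-1" _ 0])
         (auto intro!: Bochner_Integration.integral_cong simp: indicator_def)
    with fg[of "-y" "-x"] that show ?thesis by simp
  qed
  obtain N' where N': "negligible N'"
    "\<And>x. x \<notin> N' \<Longrightarrow> ((\<lambda>x. - f (- x)) has_real_derivative g (- x)) (at_right x)"
    using integral_has_right_derivative[OF g' fg'] by blast
  have neg: "negligible (N \<union> uminus ` N')"
    using N(1) N'(1) by (auto intro!: negligible_differentiable_image_negligible derivative_intros simp: differentiable_on_def)
  have "(f has_real_derivative g x) (at x)" if "x \<notin> N \<union> uminus ` N'" for x
  proof -
    have "- x \<notin> N'" using that by (metis UnCI image_eqI minus_minus)
    from N'(2)[OF this] have "((\<lambda>y. (- f (- y) - - f x) / (y - - x)) \<longlongrightarrow> g x) (at_right (- x))"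
      by (simp add: has_field_derivative_iff)
    then have "((\<lambda>y. (- f (- (- y)) - - f x) / (- y - - x)) \<longlongrightarrow> g x) (at_left x)"
      by (subst filterlim_at_left_to_right) (simp add: add.commute)
    moreover have "(- f (- (- y)) - - f x) / (- y - - x) = (f y - f x) / (y - x)" for y
      using minus_divide_divide[of "f y - f x" "y - x"] by simp
    ultimately have "((\<lambda>y. (f y - f x) / (y - x)) \<longlongrightarrow> g x) (at_left x)" by simp
    moreover have "((\<lambda>y. (f y - f x) / (y - x)) \<longlongrightarrow> g x) (at_right x)"
      using N(2)[of x] that by (simp add: has_field_derivative_iff)
    ultimately show ?thesis
      unfolding has_field_derivative_iff by (rule filterlim_split_at)
  qed
  then have "AE x in lebesgue. (f has_real_derivative g x) (at x)"
    using neg unfolding negligible_iff_null_sets by (intro AE_I'[of "N \<union> uminus ` N'"]) auto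
  then show ?thesis by (simp add: AE_completion_iff)
qed

section \<open>Primitives of integrable functions\<close>

lemma LBINT_Ioc_Icc:
  fixes w :: "real \<Rightarrow> real"
  assumes "w \<in> borel_measurable lborel"
  shows "(LBINT r:{x<..y}. w r) = (LBINT r:{x..y}. w r)"
  unfolding set_lebesgue_integral_def
proof (rule integral_cong_AE)
  show "AE r in lborel. indicator {x<..y} r *\<^sub>R w r = indicator {x..y} r *\<^sub>R w r"
    using AE_lborel_singleton[of x] by eventually_elim (auto simp: indicator_def)
qed (use assms in measurable)

lemma LBINT_atMost_diff:
  fixes w :: "real \<Rightarrow> real"
  assumes w: "integrable lborel w" and "x \<le> y"
  shows "(LBINT r:{..y}. w r) - (LBINT r:{..x}. w r) = (LBINT r:{x..y}. w r)"
proof -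
  have "(LBINT r:{..x} \<union> {x<..y}. w r) = (LBINT r:{..x}. w r) + (LBINT r:{x<..y}. w r)"
    by (rule set_integral_Un) (auto intro: set_integrable_of_integrable[OF w])
  moreover have "{..x} \<union> {x<..y} = {..y}" using \<open>x \<le> y\<close> by auto
  moreover have "(LBINT r:{x<..y}. w r) = (LBINT r:{x..y}. w r)"
    by (rule LBINT_Ioc_Icc) (use w in auto)
  ultimately show ?thesis by simp
qed

lemma isCont_LBINT_atMost:
  fixes w :: "real \<Rightarrow> real"
  assumes w: "integrable lborel w"
  shows "isCont (\<lambda>x. LBINT r:{..x}. w r) x"
proof -
  let ?W = "\<lambda>x. LBINT r:{..x}. w r"
  note si = set_borel_integral_eq_integral[OF set_integrable_of_integrable[OF w]]
  have "continuous_on {x-1..x+1} (\<lambda>y. integral {x-1..y} w)"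
    by (rule indefinite_integral_continuous_1) (use si(1) in auto)
  then have "continuous_on {x-1..x+1} (\<lambda>y. ?W (x-1) + integral {x-1..y} w)"
    by (intro continuous_intros)
  moreover have "?W (x-1) + integral {x-1..y} w = ?W y" if "y \<in> {x-1..x+1}" for y
    using LBINT_atMost_diff[OF w, of "x-1" y] si(2)[of "{x-1..y}"] that by simp
  ultimately have "continuous_on {x-1..x+1} ?W" by (rule continuous_on_eq)
  then show ?thesis by (rule continuous_on_interior) auto
qed

text \<open>
  With \<open>W\<close> a primitive of \<open>w\<close>, the Stieltjes measures of the monotone functions \<open>W + f\<close> and
  \<open>W - f\<close> add up to the measure with density \<open>2 w\<close>, so Radon-Nikodym applies to the first one.
\<close>

lemma density_of_dominated_increments:
  fixes f w :: "real \<Rightarrow> real"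
  assumes w: "integrable lborel w" and w0: "\<And>x. 0 \<le> w x"
    and fw: "\<And>x y. x \<le> y \<Longrightarrow> \<bar>f y - f x\<bar> \<le> (LBINT r:{x..y}. w r)"
  obtains g where "integrable lborel g"
    "\<And>x y. x \<le> y \<Longrightarrow> f y - f x = (LBINT r:{x..y}. g r)"
proof -
  note si = set_integrable_of_integrable[OF w]
  define W where "W x = (LBINT r:{..x}. w r)" for x
  have Wdiff: "W y - W x = (LBINT r:{x..y}. w r)" if "x \<le> y" for x y
    unfolding W_def by (rule LBINT_atMost_diff[OF w that])
  have Wcont: "isCont W x" for x
    unfolding W_def by (rule isCont_LBINT_atMost[OF w])
  \<comment> \<open>Continuity of \<open>f\<close> makes \<open>W + f\<close> and
    \<open>W - f\<close> right-continuous, which \<open>interval_measure\<close> requires in order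
    to assign the increment to a half-open interval.\<close>
  have contf: "isCont f x" for x
  proof -
    have "((\<lambda>y. \<bar>W y - W x\<bar>) \<longlongrightarrow> 0) (at x)"
    proof -
      have "(W \<longlongrightarrow> W x) (at x)" using Wcont by (simp add: isCont_def)
      then show ?thesis by (intro tendsto_rabs_zero) (simp add: LIM_zero_iff)
    qed
    moreover have "norm (f y - f x) \<le> \<bar>W y - W x\<bar>" for y
      using fw[of x y] fw[of y x] Wdiff[of x y] Wdiff[of y x] by (cases "x \<le> y") auto
    ultimately have "((\<lambda>y. f y - f x) \<longlongrightarrow> 0) (at x)"
      by (rule Lim_null_comparison[OF eventuallyI, rotated])
    then show ?thesis by (simp add: isCont_def LIM_zero_iff)
  qed
  define G H where "G x = W x + f x" and "H x = W x - f x" for x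
  have monoG: "G x \<le> G y" and monoH: "H x \<le> H y" if "x \<le> y" for x y
    using fw[OF that] Wdiff[OF that] by (auto simp: G_def H_def)
  have "isCont G x" "isCont H x" for x
    unfolding G_def H_def by (intro continuous_intros Wcont contf)+
  then have cG: "continuous (at_right x) G" and cH: "continuous (at_right x) H" for x
    by (blast intro: continuous_at_imp_continuous_within)+
  let ?G = "interval_measure G" and ?H = "interval_measure H"
  define S where "S = measure_of UNIV (sets borel) (\<lambda>A. emeasure ?G A + emeasure ?H A)"
  define K where "K = density lborel (\<lambda>x. ennreal (2 * w x))"
  have setsS: "sets S = sets borel"
    unfolding S_def using sets.sets_measure_of_eq[of borel] by simp
  have emS: "emeasure S A = emeasure ?G A + emeasure ?H A" if "A \<in> sets borel" for A
    unfolding S_def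
  proof (rule emeasure_measure_of_sigma)
    show "sigma_algebra UNIV (sets (borel::real measure))"
      using sets.sigma_algebra_axioms[of borel] by simp
    show "positive (sets borel) (\<lambda>A. emeasure ?G A + emeasure ?H A)"
      by (simp add: positive_def)
    show "countably_additive (sets borel) (\<lambda>A. emeasure ?G A + emeasure ?H A)"
      unfolding countably_additive_def
      by (auto simp: suminf_add[symmetric] suminf_emeasure image_subset_iff)
  qed fact
  have finK: "emeasure K UNIV = ennreal (2 * (LBINT x. w x))"
    using w w0 by (simp add: K_def emeasure_density nn_integral_eq_integral)
  have KIoc: "emeasure K {x<..y} = ennreal (2 * (W y - W x))" if "x \<le> y" for x y
  proof -
    have "emeasure K {x<..y} = (\<integral>\<^sup>+r. ennreal (2 * (indicator {x<..y} r * w r)) \<partial>lborel)"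
      using w by (auto simp: K_def emeasure_density intro!: nn_integral_cong split: split_indicator)
    also have "\<dots> = ennreal (2 * (LBINT r:{x<..y}. w r))"
      using si[of "{x<..y}"] w0
      by (subst nn_integral_eq_integral) (auto simp: set_integrable_def set_lebesgue_integral_def)
    also have "(LBINT r:{x<..y}. w r) = (LBINT r:{x..y}. w r)"
      by (rule LBINT_Ioc_Icc) (use w in auto)
    finally show ?thesis by (simp add: Wdiff[OF that])
  qed
  have SK: "S = K"
  proof (rule measure_eqI_generator_eq[where E="range (\<lambda>(a, b). {a<..b::real})" and A="\<lambda>i. {-real i<..real i}" and \<Omega>=UNIV])
    show "Int_stable (range (\<lambda>(a, b). {a<..b::real}))"
      by (auto simp: Int_stable_def image_iff)
    show "emeasure S X = emeasure K X" if "X \<in> range (\<lambda>(a, b). {a<..b::real})" for X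
    proof -
      obtain a b where X: "X = {a<..b}" using \<open>X \<in> _\<close> by auto
      show ?thesis
      proof (cases "a \<le> b")
        case True
        then show ?thesis
          using monoG[OF True] monoH[OF True]
          by (simp add: X emS KIoc emeasure_interval_measure_Ioc monoG monoH cG cH flip: ennreal_plus)
            (simp add: G_def H_def)
      qed (simp add: X)
    qed
    show "sets S = sigma_sets UNIV (range (\<lambda>(a, b). {a<..b::real}))"
      using setsS by (simp add: borel_sigma_sets_Ioc)
    show "sets K = sigma_sets UNIV (range (\<lambda>(a, b). {a<..b::real}))"
      by (simp add: K_def borel_sigma_sets_Ioc)
    show "(\<Union>i. {- real i<..real i}) = UNIV"
    proof -
      have "\<exists>i. - real i < x \<and> x \<le> real i" for x
      proof -
        obtain i where "\<bar>x\<bar> < real i" using reals_Archimedean2 by blast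
        then show ?thesis by (intro exI[of _ i]) auto
      qed
      then show ?thesis by auto
    qed
    show "emeasure S {- real i<..real i} \<noteq> \<infinity>" for i
      by (simp add: emS emeasure_interval_measure_Ioc monoG monoH cG cH)
  qed auto
  \<comment> \<open>\<open>?G\<close> is a summand of \<open>S = K\<close>, and \<open>K\<close> has
    a density, so \<open>?G\<close> vanishes on Lebesgue null sets.\<close>
  have "absolutely_continuous lborel ?G"
    unfolding absolutely_continuous_def
  proof
    fix A :: "real set" assume A: "A \<in> null_sets lborel"
    then have "emeasure K A = 0" "A \<in> sets borel"
      using w absolutely_continuousI_density[of "\<lambda>x. ennreal (2 * w x)" lborel]
      by (auto simp: K_def absolutely_continuous_def null_sets_def)
    then have "emeasure ?G A = 0" using emS[of A] SK by simp
    with \<open>A \<in> sets borel\<close> show "A \<in> null_sets ?G" by auto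
  qed
  then obtain h where h: "h \<in> borel_measurable lborel" "density lborel h = ?G"
    using sigma_finite_measure.Radon_Nikodym[OF sigma_finite_lborel, of ?G] by auto
  have hem: "emeasure ?G A = (\<integral>\<^sup>+x. h x * indicator A x \<partial>lborel)" if "A \<in> sets borel" for A
    unfolding h(2)[symmetric] by (rule emeasure_density) (use h(1) that in auto)
  have hfin: "(\<integral>\<^sup>+x. h x \<partial>lborel) < \<infinity>"
  proof -
    have "(\<integral>\<^sup>+x. h x \<partial>lborel) = emeasure ?G UNIV" using hem[of UNIV] by simp
    also have "\<dots> \<le> emeasure K UNIV" using emS[of UNIV] SK by simp
    finally show ?thesis using finK by (metis ennreal_less_top infinity_ennreal_def le_less_trans)
  qed
  have hAE: "AE x in lborel. h x = ennreal (enn2real (h x))"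
    using nn_integral_PInf_AE[OF h(1)] hfin by (auto simp: less_top)
  have hint: "integrable lborel (\<lambda>x. enn2real (h x))"
  proof (rule integrableI_nonneg)
    show "(\<integral>\<^sup>+x. ennreal (enn2real (h x)) \<partial>lborel) < \<infinity>"
      using hfin hAE nn_integral_cong_AE[OF hAE] by simp
  qed (use h(1) in auto)
  have Gd: "G y - G x = (LBINT r:{x..y}. enn2real (h r))" if "x \<le> y" for x y
  proof -
    have hs: "integrable lborel (\<lambda>r. indicator {x..y} r * enn2real (h r))"
      using integrable_mult_indicator[OF _ hint, of "{x..y}"] by simp
    have "ennreal (G y - G x) = emeasure ?G {x<..y}"
      using that by (simp add: emeasure_interval_measure_Ioc monoG cG)
    also have "\<dots> = (\<integral>\<^sup>+r. h r * indicator {x<..y} r \<partial>lborel)"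
      by (simp add: hem)
    also have "\<dots> = (\<integral>\<^sup>+r. ennreal (indicator {x..y} r * enn2real (h r)) \<partial>lborel)"
      by (rule nn_integral_cong_AE)
         (use hAE AE_lborel_singleton[of x] in \<open>eventually_elim, auto simp: indicator_def\<close>)
    also have "\<dots> = ennreal (LBINT r:{x..y}. enn2real (h r))"
      using nn_integral_eq_integral[OF hs] by (simp add: set_lebesgue_integral_def)
    finally show ?thesis
      using monoG[OF that] by (subst (asm) ennreal_inj) (auto simp: set_lebesgue_integral_def intro!: Bochner_Integration.integral_nonneg)
  qed
  \<comment> \<open>Since \<open>f = G - W\<close>, the density of \<open>f\<close> is that of
    \<open>G\<close> minus \<open>w\<close>.\<close>
  show ?thesis
  proof (rule that[of "\<lambda>x. enn2real (h x) - w x"])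
    show "integrable lborel (\<lambda>x. enn2real (h x) - w x)" using hint w by simp
    show "f y - f x = (LBINT r:{x..y}. enn2real (h r) - w r)" if "x \<le> y" for x y
    proof -
      have "set_integrable lborel {x..y} (\<lambda>r. enn2real (h r))"
        using integrable_mult_indicator[OF _ hint, of "{x..y}"] by (simp add: set_integrable_def)
      then show ?thesis
        using Gd[OF that] Wdiff[OF that] by (simp add: set_integral_diff si G_def)
    qed
  qed
qed

text \<open>
  The metric derivative is the supremum over rational \<open>q\<close> of the absolute values of the derivatives
  of \<open>x \<mapsto> dist (u q) (u x)\<close>; the truncation of these by \<open>w\<close> in \<open>k\<close> keeps the supremum finite everywhere.
\<close>

lemma metric_speed:
  fixes u :: "real \<Rightarrow> 'a::metric_space" and w :: "real \<Rightarrow> real"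
  assumes w: "integrable lborel w" and w0: "\<And>x. 0 \<le> w x"
    and uw: "\<And>x y. x \<le> y \<Longrightarrow> dist (u x) (u y) \<le> (LBINT r:{x..y}. w r)"
  obtains M where "integrable lborel M" "\<And>x. 0 \<le> M x"
    "\<And>x y. x \<le> y \<Longrightarrow> dist (u x) (u y) \<le> (LBINT r:{x..y}. M r)"
    "AE x in lborel. ((\<lambda>s. dist (u s) (u x) / \<bar>s - x\<bar>) \<longlongrightarrow> M x) (at x)"
proof -
  define W where "W x = (LBINT r:{..x}. w r)" for x
  have Wdiff: "W y - W x = (LBINT r:{x..y}. w r)" if "x \<le> y" for x y
    unfolding W_def by (rule LBINT_atMost_diff[OF w that])
  have Wcont: "isCont W x" for x
    unfolding W_def by (rule isCont_LBINT_atMost[OF w])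
  have distW: "dist (u x) (u y) \<le> \<bar>W y - W x\<bar>" for x y
    using uw[of x y] uw[of y x] Wdiff[of x y] Wdiff[of y x]
    by (cases "x \<le> y") (auto simp: dist_commute)
  have tri: "\<bar>dist (u q) (u y) - dist (u q) (u x)\<bar> \<le> dist (u x) (u y)" for q x y
    using abs_dist_diff_le[of "u y" "u q" "u x"] by (simp add: dist_commute)
  have "\<exists>g. integrable lborel g \<and>
      (\<forall>x y. x \<le> y \<longrightarrow> dist (u q) (u y) - dist (u q) (u x) = (LBINT r:{x..y}. g r))" for q
  proof -
    have "\<bar>dist (u q) (u y) - dist (u q) (u x)\<bar> \<le> (LBINT r:{x..y}. w r)" if "x \<le> y" for x y
      using tri uw[OF that] by (rule order_trans)
    then obtain g' where "integrable lborel g'"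
      "\<And>x y. x \<le> y \<Longrightarrow> dist (u q) (u y) - dist (u q) (u x) = (LBINT r:{x..y}. g' r)"
      using density_of_dominated_increments[OF w w0, of "\<lambda>x. dist (u q) (u x)"] by metis
    then show ?thesis by blast
  qed
  then obtain g where g: "\<And>q. integrable lborel (g q)"
    "\<And>q x y. x \<le> y \<Longrightarrow> dist (u q) (u y) - dist (u q) (u x) = (LBINT r:{x..y}. g q r)"
    by metis
  have gAE: "AE x in lborel. \<forall>q\<in>\<rat>. ((\<lambda>x. dist (u q) (u x)) has_real_derivative g q x) (at x)"
    by (subst AE_ball_countable) (auto intro!: countable_rat integral_has_derivative_AE g)
  have wAE: "AE x in lborel. (W has_real_derivative w x) (at x)"
    by (rule integral_has_derivative_AE[OF w Wdiff])
  \<comment> \<open>The difference quotients of all the distance functions are dominated by those of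
    \<open>W\<close>, and the derivatives inherit this. Countability of the rationals allows one
    exceptional null set for all \<open>q\<close>.\<close>
  have gw: "AE x in lborel. \<forall>q\<in>\<rat>. \<bar>g q x\<bar> \<le> w x"
    using gAE wAE
  proof eventually_elim
    case (elim x)
    have "\<bar>g q x\<bar> \<le> \<bar>w x\<bar>" if "q \<in> \<rat>" for q
    proof (rule tendsto_le[OF _ _ _ eventuallyI])
      show "((\<lambda>s. \<bar>(dist (u q) (u s) - dist (u q) (u x)) / (s - x)\<bar>) \<longlongrightarrow> \<bar>g q x\<bar>) (at x)"
        using elim that by (intro tendsto_rabs) (auto simp: has_field_derivative_iff)
      show "((\<lambda>s. \<bar>(W s - W x) / (s - x)\<bar>) \<longlongrightarrow> \<bar>w x\<bar>) (at x)"
        using elim by (intro tendsto_rabs) (auto simp: has_field_derivative_iff)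
      show "\<bar>(dist (u q) (u s) - dist (u q) (u x)) / (s - x)\<bar> \<le> \<bar>(W s - W x) / (s - x)\<bar>" for s
      proof -
        have "\<bar>dist (u q) (u s) - dist (u q) (u x)\<bar> \<le> \<bar>W s - W x\<bar>"
          using tri distW[of x s] by (rule order_trans)
        then show ?thesis by (simp add: abs_divide divide_right_mono)
      qed
    qed auto
    then show ?case using w0[of x] by simp
  qed
  define k where "k q x = min \<bar>g q x\<bar> (w x)" for q x
  define M where "M x = (SUP q\<in>\<rat>. k q x)" for x
  have bdd: "bdd_above ((\<lambda>q. k q x) ` \<rat>)" for x
    by (rule bdd_aboveI2[of _ _ "w x"]) (simp add: k_def)
  have ratne: "(\<rat>::real set) \<noteq> {}" by auto
  have kM: "k q x \<le> M x" if "q \<in> \<rat>" for q x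
    unfolding M_def by (rule cSUP_upper[OF that bdd])
  have M0: "0 \<le> M x" for x
    using kM[OF Rats_0, of x] w0[of x] by (simp add: k_def)
  have Mw: "M x \<le> w x" for x
    unfolding M_def by (rule cSUP_least[OF ratne]) (simp add: k_def)
  have kint: "integrable lborel (k q)" for q
    using g(1) w unfolding k_def by (intro integrable_min integrable_abs)
  have Mint: "integrable lborel M"
  proof (rule Bochner_Integration.integrable_bound[OF w])
    show "M \<in> borel_measurable lborel"
      unfolding M_def[abs_def]
      by (rule borel_measurable_cSUP) (use kint countable_rat bdd in auto)
  qed (use M0 Mw w0 in auto)
  have uM: "dist (u x) (u y) \<le> (LBINT r:{x..y}. M r)" if "x \<le> y" for x y
  proof -
    \<comment> \<open>For rational \<open>q n\<close> close to \<open>x\<close>, replacing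
      \<open>u x\<close> by \<open>u (q n)\<close> in the distance to \<open>u y\<close>, and
      introducing the term \<open>dist (u (q n)) (u x)\<close>, costs at most
      \<open>\<bar>W (q n) - W x\<bar>\<close> each. This explains the factor 2; the error vanishes
      in the limit because \<open>W\<close> is continuous.\<close>
    have "x \<in> closure \<rat>"
      by (simp add: Rats_closure_real)
    then obtain q where q: "\<And>n. q n \<in> \<rat>" "q \<longlonglongrightarrow> x"
      unfolding closure_sequential by blast
    have "(\<lambda>n. W (q n)) \<longlonglongrightarrow> W x" using isCont_tendsto_compose[OF Wcont q(2)] .
    then have "(\<lambda>n. \<bar>W (q n) - W x\<bar>) \<longlonglongrightarrow> 0" by (intro tendsto_rabs_zero) (simp add: LIM_zero_iff)
    then have "(\<lambda>n. dist (u x) (u y) - 2 * \<bar>W (q n) - W x\<bar>) \<longlonglongrightarrow> dist (u x) (u y) - 2 * 0"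
      by (intro tendsto_intros)
    moreover have "dist (u x) (u y) - 2 * \<bar>W (q n) - W x\<bar> \<le> (LBINT r:{x..y}. M r)" for n
    proof -
      have "dist (u x) (u y) - 2 * \<bar>W (q n) - W x\<bar> \<le> dist (u (q n)) (u y) - dist (u (q n)) (u x)"
        using distW[of x "q n"] dist_triangle[of "u x" "u y" "u (q n)"] by (simp add: dist_commute)
      also have "\<dots> = (LBINT r:{x..y}. g (q n) r)" by (rule g(2)[OF that])
      also have "\<dots> \<le> (LBINT r:{x..y}. k (q n) r)"
        unfolding set_lebesgue_integral_def
      proof (rule integral_mono_AE)
        show "integrable lborel (\<lambda>r. indicator {x..y} r *\<^sub>R g (q n) r)"
          by (rule integrable_mult_indicator) (use g(1) in auto)
        show "integrable lborel (\<lambda>r. indicator {x..y} r *\<^sub>R k (q n) r)"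
          by (rule integrable_mult_indicator) (use kint in auto)
        show "AE r in lborel. indicator {x..y} r *\<^sub>R g (q n) r \<le> indicator {x..y} r *\<^sub>R k (q n) r"
          using gw by eventually_elim
            (use q(1)[of n] in \<open>auto simp: indicator_def k_def\<close>)
      qed
      also have "\<dots> \<le> (LBINT r:{x..y}. M r)"
        by (rule set_integral_mono)
          (use kint Mint kM q(1) in \<open>auto intro: set_integrable_of_integrable\<close>)
      finally show ?thesis .
    qed
    ultimately show ?thesis by (intro LIMSEQ_le_const2[of _ "dist (u x) (u y)"]) auto
  qed
  define V where "V x = (LBINT r:{..x}. M r)" for x
  have Vdiff: "V y - V x = (LBINT r:{x..y}. M r)" if "x \<le> y" for x y
    unfolding V_def by (rule LBINT_atMost_diff[OF Mint that])
  have distV: "dist (u x) (u y) \<le> \<bar>V y - V x\<bar>" for x y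
    using uM[of x y] uM[of y x] Vdiff[of x y] Vdiff[of y x]
    by (cases "x \<le> y") (auto simp: dist_commute)
  have VAE: "AE x in lborel. (V has_real_derivative M x) (at x)"
    by (rule integral_has_derivative_AE[OF Mint Vdiff])
  have "AE x in lborel. ((\<lambda>s. dist (u s) (u x) / \<bar>s - x\<bar>) \<longlongrightarrow> M x) (at x)"
    using gAE VAE gw
  proof eventually_elim
    case (elim x)
    show ?case
    proof (rule order_tendstoI)
      \<comment> \<open>Lower bound: a single rational \<open>q\<close> with
        \<open>c < k q x\<close> suffices, because the quotients of the distance to
        \<open>u q\<close> never exceed those of the curve itself.\<close>
      fix c assume "c < M x"
      then obtain q where q: "q \<in> \<rat>" "c < k q x"
        unfolding M_def using less_cSUP_iff[OF ratne bdd] by blast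
      have "((\<lambda>s. \<bar>(dist (u q) (u s) - dist (u q) (u x)) / (s - x)\<bar>) \<longlongrightarrow> \<bar>g q x\<bar>) (at x)"
        using elim q by (intro tendsto_rabs) (auto simp: has_field_derivative_iff)
      moreover have "c < \<bar>g q x\<bar>" using q by (simp add: k_def)
      ultimately have "\<forall>\<^sub>F s in at x. c < \<bar>(dist (u q) (u s) - dist (u q) (u x)) / (s - x)\<bar>"
        by (rule order_tendstoD)
      then show "\<forall>\<^sub>F s in at x. c < dist (u s) (u x) / \<bar>s - x\<bar>"
      proof eventually_elim
        case (elim s)
        have "\<bar>dist (u q) (u s) - dist (u q) (u x)\<bar> \<le> dist (u s) (u x)"
          using tri[of q s x] by (simp add: dist_commute)
        then have "\<bar>(dist (u q) (u s) - dist (u q) (u x)) / (s - x)\<bar> \<le> dist (u s) (u x) / \<bar>s - x\<bar>"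
          by (simp add: abs_divide divide_right_mono)
        with elim show ?case by simp
      qed
    next
      \<comment> \<open>Upper bound: distances along the curve are dominated by increments of the
        primitive \<open>V\<close> of \<open>M\<close>, whose derivative at \<open>x\<close> is
        \<open>M x\<close>.\<close>
      fix c assume c: "M x < c"
      have "((\<lambda>s. \<bar>(V s - V x) / (s - x)\<bar>) \<longlongrightarrow> \<bar>M x\<bar>) (at x)"
        using elim by (intro tendsto_rabs) (auto simp: has_field_derivative_iff)
      then have "\<forall>\<^sub>F s in at x. \<bar>(V s - V x) / (s - x)\<bar> < c"
        using c M0[of x] by (intro order_tendstoD) auto
      then show "\<forall>\<^sub>F s in at x. dist (u s) (u x) / \<bar>s - x\<bar> < c"
      proof eventually_elim
        case (elim s)
        have "dist (u s) (u x) / \<bar>s - x\<bar> \<le> \<bar>V s - V x\<bar> / \<bar>s - x\<bar>"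
          using distV[of s x] by (intro divide_right_mono) auto
        with elim show ?case by (simp add: abs_divide)
      qed
    qed
  qed
  with Mint M0 uM show ?thesis by (rule that)
qed

text \<open>The clamp \<open>cl\<close> freezes the curve outside \<open>[a,b]\<close>, so that
  \<open>metric_speed\<close> applies on the whole line with an integrable \<open>w\<close>. Near a
  point of the open interval the clamp changes nothing, hence the speed \<open>M\<close> found there
  is \<open>metric_deriv v\<close>.\<close>

lemma dist_le_curve_length:
  fixes v :: "real \<Rightarrow> 'a::metric_space" and m :: "real \<Rightarrow> real"
  assumes "a < b" and m: "set_integrable lborel {a..b} m"
    and vm: "\<And>x y. \<lbrakk>a \<le> x; x \<le> y; y \<le> b\<rbrakk> \<Longrightarrow> dist (v x) (v y) \<le> (LBINT r:{x..y}. m r)"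
  shows "ennreal (dist (v a) (v b)) \<le> curve_length (ereal a) (ereal b) v"
proof -
  define cl where "cl x = max a (min b x)" for x
  define w where "w x = \<bar>indicator {a..b} x * m x\<bar>" for x
  have mi: "integrable lborel (\<lambda>x. indicator {a..b} x * m x)"
    using m by (simp add: set_integrable_def)
  have w: "integrable lborel w" unfolding w_def by (intro integrable_abs mi)
  have w0: "0 \<le> w x" for x by (simp add: w_def)
  have "dist (v (cl x)) (v (cl y)) \<le> (LBINT r:{x..y}. w r)" if "x \<le> y" for x y
  proof (cases "cl x = cl y")
    case True
    then show ?thesis
      by (auto simp: set_lebesgue_integral_def w0 intro!: Bochner_Integration.integral_nonneg)
  next
    case False
    then have sub: "{cl x..cl y} \<subseteq> {x..y} \<inter> {a..b}"
      using that \<open>a < b\<close> by (auto simp: cl_def max_def min_def split: if_splits)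
    have "dist (v (cl x)) (v (cl y)) \<le> (LBINT r:{cl x..cl y}. m r)"
      using that \<open>a < b\<close> by (intro vm) (auto simp: cl_def)
    also have "\<dots> \<le> (LBINT r:{x..y}. w r)"
      unfolding set_lebesgue_integral_def
    proof (rule integral_mono)
      show "integrable lborel (\<lambda>r. indicator {cl x..cl y} r *\<^sub>R m r)"
        using set_integrable_subset[OF m, of "{cl x..cl y}"] sub by (simp add: set_integrable_def)
      show "integrable lborel (\<lambda>r. indicator {x..y} r *\<^sub>R w r)"
        using integrable_mult_indicator[OF _ w, of "{x..y}"] by simp
      show "indicator {cl x..cl y} r *\<^sub>R m r \<le> indicator {x..y} r *\<^sub>R w r" for r
        using sub by (auto simp: indicator_def w_def)
    qed
    finally show ?thesis .
  qed
  from metric_speed[OF w w0, of "\<lambda>x. v (cl x)", OF this]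
  obtain M where M: "integrable lborel M" "\<And>x. 0 \<le> M x"
    "\<And>x y. x \<le> y \<Longrightarrow> dist (v (cl x)) (v (cl y)) \<le> (LBINT r:{x..y}. M r)"
    "AE x in lborel. ((\<lambda>s. dist (v (cl s)) (v (cl x)) / \<bar>s - x\<bar>) \<longlongrightarrow> M x) (at x)"
    by blast
  have md: "AE x in lborel. x \<in> {a<..<b} \<longrightarrow> metric_deriv v x = M x"
    using M(4)
  proof eventually_elim
    case (elim x)
    show ?case
    proof
      assume x: "x \<in> {a<..<b}"
      have "\<forall>\<^sub>F s in at x. s \<in> {a<..<b}"
        using x by (intro eventually_at_in_open') auto
      then have "\<forall>\<^sub>F s in at x. dist (v (cl s)) (v (cl x)) / \<bar>s - x\<bar> = dist (v s) (v x) / \<bar>s - x\<bar>"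
        by eventually_elim (use x in \<open>auto simp: cl_def\<close>)
      then have "((\<lambda>s. dist (v s) (v x) / \<bar>s - x\<bar>) \<longlongrightarrow> M x) (at x)"
        using elim by (rule Lim_transform_eventually[rotated])
      then show "metric_deriv v x = M x"
        unfolding metric_deriv_def by (intro tendsto_Lim) auto
    qed
  qed
  have "dist (v a) (v b) \<le> (LBINT r:{a..b}. M r)"
    using M(3)[of a b] \<open>a < b\<close> by (simp add: cl_def)
  then have "ennreal (dist (v a) (v b)) \<le> ennreal (LBINT r:{a..b}. M r)"
    by (rule ennreal_leI)
  also have "\<dots> = (\<integral>\<^sup>+r. ennreal (indicator {a..b} r * M r) \<partial>lborel)"
    using integrable_mult_indicator[OF _ M(1), of "{a..b}"] M(2)
    by (subst nn_integral_eq_integral) (auto simp: set_lebesgue_integral_def)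
  also have "\<dots> = curve_length (ereal a) (ereal b) v"
    unfolding curve_length_def
    by (rule nn_integral_cong_AE)
      (use md AE_lborel_singleton[of a] AE_lborel_singleton[of b] in
        \<open>eventually_elim, auto simp: indicator_def einterval_def\<close>)
  finally show ?thesis .
qed

section \<open>Derivatives of monotone functions\<close>

text \<open>The integrals of \<open>F\<close> over \<open>[s,t]\<close> and over its translate by
  \<open>c\<close> cancel except on two windows of length \<open>c\<close>. Over
  \<open>[s,s+c]\<close> the integral is at most \<open>c * F s\<close> by monotonicity, and over
  \<open>[t,t+c]\<close> it equals \<open>c * F t\<close> because \<open>F\<close> is constant from
  \<open>t\<close> on.\<close>

lemma clamped_antimono_diff_quotient:
  fixes F :: "real \<Rightarrow> real"
  assumes "s \<le> t" "0 < c" "c \<le> 1"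
    and anti: "\<And>x y. x \<le> y \<Longrightarrow> F y \<le> F x"
    and const: "\<And>x. t \<le> x \<Longrightarrow> F x = F t"
  shows "(\<integral>\<^sup>+r\<in>{s..t}. ennreal ((F r - F (r + c)) / c) \<partial>lborel) \<le> ennreal (F s - F t)"
proof -
  have [measurable]: "F \<in> borel_measurable borel"
    using borel_measurable_uminus[OF borel_measurable_mono[of "\<lambda>x. - F x"]] anti
    by (simp add: mono_def)
  \<comment> \<open>The cutoff makes \<open>F\<close> integrable. The window reaches up to
    \<open>t + 1\<close> because \<open>c \<le> 1\<close>, so that \<open>r + c\<close> stays inside
    it for every \<open>r\<close> in \<open>[s,t]\<close>.\<close>
  define F0 where "F0 x = indicator {s..t+1} x * F x" for x
  have F0: "integrable lborel F0"
  proof -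
    have "integrable lborel (\<lambda>x. indicator {s..t+1} x *\<^sub>R F x)"
    proof (rule integrableI_bounded_set_indicator[where B="\<bar>F s\<bar> + \<bar>F t\<bar>"])
      show "AE x in lborel. x \<in> {s..t+1} \<longrightarrow> norm (F x) \<le> \<bar>F s\<bar> + \<bar>F t\<bar>"
      proof (intro AE_I2 impI)
        fix x assume x: "x \<in> {s..t+1}"
        have "F x \<le> F s" using anti[of s x] x by simp
        moreover have "F t \<le> F x"
          using anti[of x t] const[of x] by (cases "x \<le> t") simp_all
        ultimately show "norm (F x) \<le> \<bar>F s\<bar> + \<bar>F t\<bar>" by simp
      qed
    qed (simp_all add: emeasure_lborel_Icc_eq)
    then show ?thesis by (simp add: F0_def[abs_def])
  qed
  have F0c: "integrable lborel (\<lambda>x. F0 (x + c))"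
    using lborel_integrable_real_affine[OF F0, of 1 c] by (simp add: add.commute)
  define P where "P x = (LBINT r:{..x}. F0 r)" for x
  have P: "P y - P x = (LBINT r:{x..y}. F0 r)" if "x \<le> y" for x y
    unfolding P_def by (rule LBINT_atMost_diff[OF F0 that])
  have shift: "(LBINT r:{s..t}. F0 (r + c)) = (LBINT r:{s+c..t+c}. F0 r)"
    unfolding set_lebesgue_integral_def
    by (subst (2) lborel_integral_real_affine[of 1 _ c])
       (auto intro!: Bochner_Integration.integral_cong simp: indicator_def add.commute)
  have up: "(LBINT r:{s..s+c}. F0 r) \<le> c * F s"
  proof -
    have "(LBINT r:{s..s+c}. F0 r) \<le> (LBINT r:{s..s+c}. F s)"
    proof (rule set_integral_mono)
      show "set_integrable lborel {s..s+c} F0" by (rule set_integrable_of_integrable[OF F0]) auto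
      show "set_integrable lborel {s..s+c} (\<lambda>_. F s)" by (simp add: set_integrable_def integrable_indicator_iff emeasure_lborel_Icc_eq)
      show "F0 x \<le> F s" if "x \<in> {s..s+c}" for x
        using that assms anti[of s x] by (auto simp: F0_def indicator_def)
    qed
    also have "\<dots> = c * F s" using \<open>0 < c\<close> by (simp add: set_lebesgue_integral_def)
    finally show ?thesis .
  qed
  have lo: "(LBINT r:{t..t+c}. F0 r) = c * F t"
  proof -
    have "(LBINT r:{t..t+c}. F0 r) = (LBINT r:{t..t+c}. F t)"
    proof (rule set_lebesgue_integral_cong)
      have "F0 x = F t" if "x \<in> {t..t+c}" for x
        using const[of x] that assms(1-3) by (auto simp: F0_def indicator_def)
      then show "\<forall>x. x \<in> {t..t+c} \<longrightarrow> F0 x = F t" by blast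
    qed simp
    then show ?thesis using \<open>0 < c\<close> by (simp add: set_lebesgue_integral_def)
  qed
  have int: "set_integrable lborel {s..t} (\<lambda>r. F0 r - F0 (r + c))"
    by (rule set_integrable_of_integrable) (use F0 F0c in auto)
  have "(\<integral>\<^sup>+r\<in>{s..t}. ennreal ((F r - F (r + c)) / c) \<partial>lborel)
      = (\<integral>\<^sup>+r. ennreal (indicator {s..t} r *\<^sub>R (F0 r - F0 (r + c)) / c) \<partial>lborel)"
    by (rule nn_integral_cong) (use assms(1-3) in \<open>auto simp: F0_def indicator_def\<close>)
  also have "\<dots> = ennreal (\<integral>r. indicator {s..t} r *\<^sub>R (F0 r - F0 (r + c)) / c \<partial>lborel)"
  proof (rule nn_integral_eq_integral)
    show "integrable lborel (\<lambda>r. indicator {s..t} r *\<^sub>R (F0 r - F0 (r + c)) / c)"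
      using int unfolding set_integrable_def by (rule integrable_divide)
    show "AE r in lborel. 0 \<le> indicator {s..t} r *\<^sub>R (F0 r - F0 (r + c)) / c"
      using assms(1-3) anti by (auto simp: F0_def indicator_def)
  qed
  also have "(\<integral>r. indicator {s..t} r *\<^sub>R (F0 r - F0 (r + c)) / c \<partial>lborel)
      = ((LBINT r:{s..t}. F0 r) - (LBINT r:{s..t}. F0 (r + c))) / c"
    using set_integral_diff(2)[OF set_integrable_of_integrable[OF F0] set_integrable_of_integrable[OF F0c], of "{s..t}"]
    by (simp add: set_lebesgue_integral_def)
  also have "\<dots> \<le> F s - F t"
    using up lo P[of s t] P[of "s+c" "t+c"] P[of s "s+c"] P[of t "t+c"] assms(1-3)
    by (simp add: shift field_simps)
  finally show ?thesis by (simp add: ennreal_leI)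
qed

text \<open>
  The witness is the lower limit of the difference quotients: it is measurable and Fatou's
  lemma applies to it.
\<close>

lemma antimono_derivative_bound:
  fixes f :: "real \<Rightarrow> real"
  assumes anti: "\<And>x y. \<lbrakk>x \<in> einterval a b; y \<in> einterval a b; x \<le> y\<rbrakk> \<Longrightarrow> f y \<le> f x"
  obtains h :: "real \<Rightarrow> ennreal" where "h \<in> borel_measurable borel"
    "\<And>x D. \<lbrakk>x \<in> einterval a b; (f has_real_derivative D) (at x)\<rbrakk> \<Longrightarrow> h x = ennreal (- D)"
    "\<And>s t. \<lbrakk>s \<in> einterval a b; t \<in> einterval a b; s \<le> t\<rbrakk>
      \<Longrightarrow> (\<integral>\<^sup>+r\<in>{s..t}. h r \<partial>lborel) \<le> ennreal (f s - f t)"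
proof -
  define c where "c n = 1 / real (Suc n)" for n
  have c: "0 < c n" "c n \<le> 1" for n by (auto simp: c_def)
  have c0: "c \<longlonglongrightarrow> 0" unfolding c_def by (rule LIMSEQ_Suc[OF lim_1_over_n])
  have c0': "filterlim c (at_right 0) sequentially"
    using c0 c(1) by (auto simp: filterlim_at less_imp_neq[symmetric])
  \<comment> \<open>The extension by zero makes the quotients Borel functions on the whole line. At
    a point of the interval the quotients involve only values of \<open>f\<close> once
    \<open>c n\<close> is small.\<close>
  define fJ where "fJ x = (if x \<in> einterval a b then f x else 0)" for x
  have [measurable]: "fJ \<in> borel_measurable borel"
  proof -
    have "mono_on (einterval a b) (\<lambda>x. - f x)"
      using anti by (intro mono_onI) auto
    then have "(\<lambda>x. - f x) \<in> borel_measurable (restrict_space borel (einterval a b))"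
      by (rule borel_measurable_mono_on_fnc)
    from borel_measurable_uminus[OF this]
    have "f \<in> borel_measurable (restrict_space borel (einterval a b))" by simp
    then show ?thesis
      by (subst (asm) borel_measurable_restrict_space_iff)
        (auto simp: indicator_def fJ_def[abs_def] of_bool_def if_distrib if_distribR cong: if_cong)
  qed
  define h where "h x = liminf (\<lambda>n. ennreal ((fJ x - fJ (x + c n)) / c n))" for x
  have [measurable]: "h \<in> borel_measurable borel" unfolding h_def by measurable
  have ev: "\<forall>\<^sub>F n in sequentially. x + c n < u" if "x < u" for x u
    using order_tendstoD(2)[OF c0, of "u - x"] that by (auto elim: eventually_mono)
  show ?thesis
  proof (rule that[of h])
    fix x D assume x: "x \<in> einterval a b" and D: "(f has_real_derivative D) (at x)"
    from x obtain u where u: "x < u" "ereal u < b"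
      using ereal_dense2[of x b] by (auto simp: einterval_def)
    have "((\<lambda>k. (f (x + k) - f x) / k) \<longlongrightarrow> D) (at_right 0)"
      using D unfolding DERIV_def by (rule filterlim_mono) (auto simp: at_within_le_at)
    from tendsto_minus[OF filterlim_compose[OF this c0']]
    have "(\<lambda>n. - ((f (x + c n) - f x) / c n)) \<longlonglongrightarrow> - D" .
    then have "(\<lambda>n. ennreal (- ((f (x + c n) - f x) / c n))) \<longlonglongrightarrow> ennreal (- D)"
      by (rule tendsto_ennrealI)
    moreover have "\<forall>\<^sub>F n in sequentially. ennreal (- ((f (x + c n) - f x) / c n))
        = ennreal ((fJ x - fJ (x + c n)) / c n)"
      using ev[OF u(1)]
    proof eventually_elim
      case (elim n)
      have "x + c n \<in> einterval a b"
        using x u(2) elim c(1)[of n] unfolding einterval_def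
        by (auto intro: less_trans[of _ "ereal x"] less_trans[of _ "ereal u"])
      then show ?case using x by (simp add: fJ_def minus_divide_left)
    qed
    ultimately have "(\<lambda>n. ennreal ((fJ x - fJ (x + c n)) / c n)) \<longlonglongrightarrow> ennreal (- D)"
      by (rule Lim_transform_eventually)
    then show "h x = ennreal (- D)"
      unfolding h_def by (intro lim_imp_Liminf) auto
  next
    fix s t assume st: "s \<in> einterval a b" "t \<in> einterval a b" "s \<le> t"
    then have sub: "x \<in> einterval a b" if "s \<le> x" "x \<le> t" for x
      using that unfolding einterval_def
      by (auto intro: less_le_trans[of a "ereal s"] le_less_trans[of _ "ereal t"])
    \<comment> \<open>Freezing \<open>f\<close> outside \<open>[s,t]\<close> gives a function that
      is monotone on the whole line and constant from \<open>t\<close> on. For \<open>r < t\<close>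
      its quotients agree with those of \<open>fJ\<close> as soon as \<open>r + c n < t\<close>, so
      the lower limits coincide; the point \<open>r = t\<close> is a null set.\<close>
    define F where "F x = f (max s (min t x))" for x
    have Fanti: "F y \<le> F x" if "x \<le> y" for x y
      unfolding F_def using that st by (intro anti sub) auto
    have [measurable]: "F \<in> borel_measurable borel"
      using borel_measurable_uminus[OF borel_measurable_mono[of "\<lambda>x. - F x"]] Fanti
      by (simp add: mono_def)
    have "(\<integral>\<^sup>+r\<in>{s..t}. h r \<partial>lborel)
        = (\<integral>\<^sup>+r\<in>{s..t}. liminf (\<lambda>n. ennreal ((F r - F (r + c n)) / c n)) \<partial>lborel)"
    proof (rule nn_integral_cong_AE)
      show "AE r in lborel. h r * indicator {s..t} r
          = liminf (\<lambda>n. ennreal ((F r - F (r + c n)) / c n)) * indicator {s..t} r"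
        using AE_lborel_singleton[of t]
      proof eventually_elim
        case (elim r)
        show ?case
        proof (cases "r \<in> {s..t}")
          case True
          then have "r < t" using elim by auto
          have "h r = liminf (\<lambda>n. ennreal ((F r - F (r + c n)) / c n))"
            unfolding h_def
          proof (rule Liminf_eq)
            show "\<forall>\<^sub>F n in sequentially. ennreal ((fJ r - fJ (r + c n)) / c n)
                = ennreal ((F r - F (r + c n)) / c n)"
              using ev[OF \<open>r < t\<close>]
              by eventually_elim (use True c(1) sub in \<open>auto simp: fJ_def F_def less_imp_le min_def max_def add_increasing2\<close>)
          qed
          then show ?thesis by simp
        qed simp
      qed
    qed
    also have "\<dots> = (\<integral>\<^sup>+r. liminf (\<lambda>n. ennreal ((F r - F (r + c n)) / c n) * indicator {s..t} r) \<partial>lborel)"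
      by (rule nn_integral_cong) (auto simp: indicator_def Liminf_const)
    also have "\<dots> \<le> liminf (\<lambda>n. \<integral>\<^sup>+r\<in>{s..t}. ennreal ((F r - F (r + c n)) / c n) \<partial>lborel)"
      by (rule nn_integral_liminf) measurable
    also have "\<dots> \<le> liminf (\<lambda>n. ennreal (F s - F t))"
      by (intro Liminf_mono always_eventually allI clamped_antimono_diff_quotient)
         (use st c Fanti in \<open>auto simp: F_def\<close>)
    also have "\<dots> = ennreal (f s - f t)"
      using st(3) by (simp add: Liminf_const F_def)
    finally show "(\<integral>\<^sup>+r\<in>{s..t}. h r \<partial>lborel) \<le> ennreal (f s - f t)" .
  qed measurable
qed

text \<open>The open interval is exhausted by an increasing sequence of compact ones, and the
  measure with density \<open>h\<close> is continuous from below.\<close>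

lemma nn_integral_einterval_le:
  fixes h :: "real \<Rightarrow> ennreal"
  assumes [measurable]: "h \<in> borel_measurable borel"
    and le: "\<And>s t. \<lbrakk>s \<in> einterval a b; t \<in> einterval a b; s \<le> t\<rbrakk> \<Longrightarrow> (\<integral>\<^sup>+r\<in>{s..t}. h r \<partial>lborel) \<le> B"
  shows "(\<integral>\<^sup>+r\<in>einterval a b. h r \<partial>lborel) \<le> B"
proof (cases "a < b")
  case True
  obtain u l :: "nat \<Rightarrow> real" where ul: "einterval a b = (\<Union>i. {l i..u i})"
    "incseq u" "decseq l" "\<And>i. l i < u i" "\<And>i. a < l i" "\<And>i. u i < b" "l \<longlonglongrightarrow> a" "u \<longlonglongrightarrow> b"
    by (rule einterval_Icc_approximation[OF True]) (rule that)
  have mem: "l i \<in> einterval a b" "u i \<in> einterval a b" for i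
    unfolding ul(1) using ul(4)[of i] by (auto intro: less_imp_le)
  have em: "emeasure (density lborel h) A = (\<integral>\<^sup>+r\<in>A. h r \<partial>lborel)" if "A \<in> sets borel" for A
    using that by (simp add: emeasure_density)
  have "incseq (\<lambda>i. {l i..u i})"
    using ul(2,3) by (auto simp: incseq_def decseq_def intro: order_trans)
  then have "(SUP i. emeasure (density lborel h) {l i..u i}) = emeasure (density lborel h) (\<Union>i. {l i..u i})"
    by (intro SUP_emeasure_incseq) auto
  then have "(\<integral>\<^sup>+r\<in>einterval a b. h r \<partial>lborel) = (SUP i. emeasure (density lborel h) {l i..u i})"
    unfolding ul(1)[symmetric] by (simp add: em)
  also have "\<dots> \<le> B"
    by (intro SUP_least) (use le[OF mem] ul(4) in \<open>simp add: em less_imp_le\<close>)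
  finally show ?thesis .
next
  case False
  then have "einterval a b = {}" by (auto simp: einterval_def dest: less_trans)
  then show ?thesis by simp
qed

section \<open>Gradient flows\<close>

text \<open>
  The last condition is what remains of the dissipation inequality after Young's inequality;
  the exponent does not occur any more.
\<close>

definition gradient_flow_on ::
    "('a::metric_space \<Rightarrow> ereal) \<Rightarrow> ('a \<Rightarrow> ennreal) \<Rightarrow> ereal \<Rightarrow> ereal \<Rightarrow> (real \<Rightarrow> 'a) \<Rightarrow> bool" where
  "gradient_flow_on E g a b v \<longleftrightarrow>
     AC_loc (einterval a b) v \<and>
     (\<forall>t\<in>einterval a b. \<bar>E (v t)\<bar> \<noteq> \<infinity>) \<and>
     (\<forall>s\<in>einterval a b. \<forall>t\<in>einterval a b. s \<le> t \<longrightarrow> E (v t) \<le> E (v s)) \<and>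
     (AE t in lborel. t \<in> einterval a b \<longrightarrow>
        (\<exists>D. ((\<lambda>r. real_of_ereal (E (v r))) has_real_derivative D) (at t) \<and>
             g (v t) * ennreal (metric_deriv v t) \<le> ennreal (- D)))"

section \<open>Translation in time and the dissipation inequality\<close>

text \<open>The equality holds at every point, even where there is no limit: \<open>Lim\<close> is a
  description, and the conditions describing the two sides are equivalent.\<close>

lemma metric_deriv_shift: "metric_deriv (\<lambda>r. v (c + r)) x = metric_deriv v (c + x)"
proof -
  have at: "at (c + x) = filtermap (\<lambda>s. c + s) (at x)"
    using filtermap_at_shift[of "- c" x] by (simp add: add.commute)
  show ?thesis
    unfolding metric_deriv_def t2_space.Lim_def[where 'a=real] Topological_Spaces.Lim_def at
    by (simp add: filterlim_filtermap)
qed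

lemma AE_lborel_shift:
  fixes c :: real
  assumes "AE x in lborel. P x"
  shows "AE x in lborel. P (x - c)"
proof -
  obtain N where N: "{x. \<not> P x} \<subseteq> N" "N \<in> sets borel" "emeasure lborel N = 0"
    using AE_E[OF assms] by auto
  have "AE x in lborel. x \<notin> N"
    using N by (intro AE_not_in) (auto simp: null_sets_def)
  then have "AE x in lborel. - c + 1 * x \<notin> N"
    by (intro AE_borel_affine) (use N(2) in auto)
  then show ?thesis
    by eventually_elim (use N(1) in auto)
qed

text \<open>Young's inequality for the conjugate exponents \<open>p'\<close> and \<open>p\<close>.
  The case \<open>m \<le> 0\<close> is included because the metric derivative is an unspecified real
  number where the limit does not exist; there \<open>ennreal m\<close> is 0.\<close>

lemma dissipation_imp_product_le:
  fixes g :: ennreal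
  assumes "1 < p" "p' = p / (p - 1)" "g < \<infinity>"
    and D: "D \<le> - (1 / p') * enn2real g powr p' - (1 / p) * m powr p"
  shows "g * ennreal m \<le> ennreal (- D)"
proof (cases "m \<le> 0")
  case False
  have p': "1 < p'" "1 / p' + 1 / p = 1"
    using assms(1) by (auto simp: assms(2) field_simps)
  have "enn2real g * m \<le> enn2real g powr p' / p' + m powr p / p"
    by (rule Youngs_inequality) (use False p' assms(1) in auto)
  also have "\<dots> \<le> - D" using D by simp
  finally have "ennreal (enn2real g * m) \<le> ennreal (- D)" by (rule ennreal_leI)
  then show ?thesis
    using False \<open>g < \<infinity>\<close> by (simp add: ennreal_mult)
qed (simp add: ennreal_neg)

lemma einterval_shift: "t \<in> einterval (ereal c) b \<longleftrightarrow> t - c \<in> einterval 0 (b - ereal c)"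
  by (cases b) (auto simp: einterval_def zero_ereal_def)

text \<open>Each piece of a piecewise flow is a flow in its own time, which starts at 0; this moves
  it back to the common time. Absolute continuity is assumed in the common time because the pieces
  provide it there.\<close>

lemma gradient_flow_on_shift:
  assumes "1 < p" and flow: "p_gradient_flow p E g (b - ereal c) (\<lambda>r. v (c + r))"
    and AC: "AC_loc (einterval (ereal c) b) v"
  shows "gradient_flow_on E g (ereal c) b v"
proof -
  let ?J = "einterval (ereal c) b" and ?I = "einterval 0 (b - ereal c)"
  have I: "t - c \<in> ?I \<longleftrightarrow> t \<in> ?J" for t by (simp add: einterval_shift)
  have fin: "\<bar>E (v t)\<bar> \<noteq> \<infinity>" if "t \<in> ?J" for t
    using flow that I[of t] unfolding p_gradient_flow_def by fastforce
  have anti: "E (v t) \<le> E (v s)" if "s \<in> ?J" "t \<in> ?J" "s \<le> t" for s t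
  proof -
    have "E (v (c + (t - c))) \<le> E (v (c + (s - c)))"
      using flow that I[of s] I[of t] unfolding p_gradient_flow_def by (metis diff_right_mono)
    then show ?thesis by simp
  qed
  have dis: "AE t in lborel. t \<in> ?J \<longrightarrow>
        (\<exists>D. ((\<lambda>r. real_of_ereal (E (v r))) has_real_derivative D) (at t) \<and>
             g (v t) * ennreal (metric_deriv v t) \<le> ennreal (- D))"
  proof -
    have "AE t in lborel. t \<in> ?I \<longrightarrow>
        (\<exists>D. ((\<lambda>r. real_of_ereal (E (v (c + r)))) has_real_derivative D) (at t) \<and>
             g (v (c + t)) * ennreal (metric_deriv (\<lambda>r. v (c + r)) t) \<le> ennreal (- D))"
      using flow unfolding p_gradient_flow_def Let_def
      by (elim conjE AE_mp) (auto intro!: AE_I2 dissipation_imp_product_le[OF \<open>1 < p\<close> refl])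
    from AE_lborel_shift[OF this, of c] show ?thesis
    proof eventually_elim
      case (elim t)
      show ?case
      proof
        assume "t \<in> ?J"
        with elim I obtain D where D:
          "((\<lambda>r. real_of_ereal (E (v (c + r)))) has_real_derivative D) (at (t - c))"
          "g (v (c + (t - c))) * ennreal (metric_deriv (\<lambda>r. v (c + r)) (t - c)) \<le> ennreal (- D)"
          by blast
        from D(1) have "((\<lambda>r. real_of_ereal (E (v r))) has_real_derivative D) (at t)"
          using DERIV_shift[of "\<lambda>r. real_of_ereal (E (v r))" D "t - c" c]
          by (simp add: add.commute)
        with D(2) show "\<exists>D. ((\<lambda>r. real_of_ereal (E (v r))) has_real_derivative D) (at t) \<and>
             g (v t) * ennreal (metric_deriv v t) \<le> ennreal (- D)"
          by (auto simp: metric_deriv_shift)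
      qed
    qed
  qed
  show ?thesis
    unfolding gradient_flow_on_def by (intro conjI ballI impI AC fin anti dis)
qed

section \<open>Restriction to subintervals and the energy along a flow\<close>

lemma L1_loc_subset: "L1_loc J m \<Longrightarrow> I \<subseteq> J \<Longrightarrow> L1_loc I m"
  unfolding L1_loc_def by blast

lemma AC_loc_subset: "AC_loc J v \<Longrightarrow> I \<subseteq> J \<Longrightarrow> AC_loc I v"
  unfolding AC_loc_def by (metis L1_loc_subset interior_mono subsetD)

lemma gradient_flow_on_subset:
  assumes "gradient_flow_on E g a b v" and sub: "einterval a' b' \<subseteq> einterval a b"
  shows "gradient_flow_on E g a' b' v"
proof -
  note * = assms(1)[unfolded gradient_flow_on_def]
  have AC: "AC_loc (einterval a' b') v" using * sub AC_loc_subset by blast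
  have dis: "AE t in lborel. t \<in> einterval a' b' \<longrightarrow>
        (\<exists>D. ((\<lambda>r. real_of_ereal (E (v r))) has_real_derivative D) (at t) \<and>
             g (v t) * ennreal (metric_deriv v t) \<le> ennreal (- D))"
    using *[THEN conjunct2, THEN conjunct2, THEN conjunct2] by eventually_elim (use sub in blast)
  have fin: "\<bar>E (v t)\<bar> \<noteq> \<infinity>" if "t \<in> einterval a' b'" for t
    using * sub that by (metis subsetD)
  have anti: "E (v t) \<le> E (v s)" if "s \<in> einterval a' b'" "t \<in> einterval a' b'" "s \<le> t" for s t
    using * sub that by (metis subsetD)
  show ?thesis
    unfolding gradient_flow_on_def by (intro conjI ballI impI AC fin anti dis)
qed

lemma einterval_convex:
  assumes "s \<in> einterval a b" "t \<in> einterval a b" shows "{s..t} \<subseteq> einterval a b"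
  using assms unfolding einterval_def
  by (auto intro: less_le_trans[of a "ereal s"] le_less_trans[of _ "ereal t"])

text \<open>An open interval is its own interior, so the distance estimate of \<open>AC_loc\<close>
  holds up to and including the endpoints \<open>s\<close> and \<open>t\<close>.\<close>

lemma AC_loc_compact:
  assumes "AC_loc (einterval a b) v" "s \<in> einterval a b" "t \<in> einterval a b"
  obtains m where "set_integrable lborel {s..t} m"
    "\<And>x y. \<lbrakk>s \<le> x; x \<le> y; y \<le> t\<rbrakk> \<Longrightarrow> dist (v x) (v y) \<le> (LBINT r:{x..y}. m r)"
proof -
  obtain m where m: "L1_loc (einterval a b) m"
    "\<And>x y. \<lbrakk>x \<in> einterval a b; y \<in> einterval a b; x \<le> y\<rbrakk> \<Longrightarrow> dist (v x) (v y) \<le> (LBINT r:{x..y}. m r)"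
    using assms(1) unfolding AC_loc_def by (auto simp: interior_open)
  note sub = einterval_convex[OF assms(2,3)]
  show ?thesis
  proof (rule that[of m])
    show "set_integrable lborel {s..t} m" using m(1) sub unfolding L1_loc_def by blast
    show "dist (v x) (v y) \<le> (LBINT r:{x..y}. m r)" if "s \<le> x" "x \<le> y" "y \<le> t" for x y
      using that sub by (intro m(2)) auto
  qed
qed

lemma gradient_flow_on_dist_le:
  assumes "gradient_flow_on E g a b v" "s \<in> einterval a b" "t \<in> einterval a b" "s < t"
  shows "ennreal (dist (v s) (v t)) \<le> curve_length (ereal s) (ereal t) v"
proof -
  obtain m where "set_integrable lborel {s..t} m"
    "\<And>x y. \<lbrakk>s \<le> x; x \<le> y; y \<le> t\<rbrakk> \<Longrightarrow> dist (v x) (v y) \<le> (LBINT r:{x..y}. m r)"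
    using AC_loc_compact[OF _ assms(2,3)] assms(1) unfolding gradient_flow_on_def by blast
  then show ?thesis by (rule dist_le_curve_length[OF \<open>s < t\<close>])
qed

lemma gradient_flow_on_energy_antimono:
  assumes "gradient_flow_on E g a b v" "s \<in> einterval a b" "t \<in> einterval a b" "s \<le> t"
  shows "real_of_ereal (E (v t)) \<le> real_of_ereal (E (v s))"
  using assms unfolding gradient_flow_on_def by (auto intro!: real_of_ereal_positive_mono simp: real_le_ereal_iff ereal_real)

text \<open>Monotonicity of the energy provides, through \<open>antimono_derivative_bound\<close>, a
  majorant \<open>h\<close> of the product of \<open>g (v t)\<close> and the speed that is
  integrable on compact subintervals. The upper gradient inequality then dominates the increments of
  the energy by those of a primitive of \<open>h\<close>, which is continuous.\<close>

lemma gradient_flow_on_energy_continuous: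
  assumes sug: "strong_upper_gradient E g" and flow: "gradient_flow_on E g a b v"
  shows "continuous_on (einterval a b) (\<lambda>t. real_of_ereal (E (v t)))"
proof -
  define e where "e t = real_of_ereal (E (v t))" for t
  have anti: "e t \<le> e s" if "s \<in> einterval a b" "t \<in> einterval a b" "s \<le> t" for s t
    unfolding e_def by (rule gradient_flow_on_energy_antimono[OF flow that])
  have eE: "E (v t) = ereal (e t)" if "t \<in> einterval a b" for t
    using flow that unfolding gradient_flow_on_def e_def by (simp add: ereal_real)
  obtain h where h: "h \<in> borel_measurable borel"
    "\<And>x D. \<lbrakk>x \<in> einterval a b; (e has_real_derivative D) (at x)\<rbrakk> \<Longrightarrow> h x = ennreal (- D)"
    "\<And>s t. \<lbrakk>s \<in> einterval a b; t \<in> einterval a b; s \<le> t\<rbrakk>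
      \<Longrightarrow> (\<integral>\<^sup>+r\<in>{s..t}. h r \<partial>lborel) \<le> ennreal (e s - e t)"
    using antimono_derivative_bound[of a b e, OF anti] by blast
  have gh: "AE t in lborel. t \<in> einterval a b \<longrightarrow> g (v t) * ennreal (metric_deriv v t) \<le> h t"
    using flow unfolding gradient_flow_on_def e_def[symmetric, abs_def]
    by (elim conjE AE_mp) (auto intro!: AE_I2 simp: h(2))
  have "isCont e x" if x: "x \<in> einterval a b" for x
  proof -
    obtain l u where lu: "l < x" "x < u" "l \<in> einterval a b" "u \<in> einterval a b"
    proof -
      obtain l u where "a < ereal l" "l < x" "x < u" "ereal u < b"
        using x ereal_dense2[of a x] ereal_dense2[of x b] by (auto simp: einterval_def)
      then show ?thesis
        using x by (intro that[of l u]) (auto simp: einterval_def intro: less_trans[of _ "ereal x"])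
    qed
    note sub = einterval_convex[OF lu(3,4)]
    have AC: "AC (ereal l) (ereal u) v"
    proof -
      obtain m where "set_integrable lborel {l..u} m"
        "\<And>x y. \<lbrakk>l \<le> x; x \<le> y; y \<le> u\<rbrakk> \<Longrightarrow> dist (v x) (v y) \<le> (LBINT r:{x..y}. m r)"
        using AC_loc_compact[OF _ lu(3,4)] flow unfolding gradient_flow_on_def by blast
      then show ?thesis
        unfolding AC_def
        by (intro exI[of _ m] conjI) (auto intro: set_integrable_subset)
    qed
    \<comment> \<open>A real-valued integrable version of \<open>h\<close> on \<open>[l,u]\<close>:
      the integral of \<open>h\<close> there is at most the energy drop \<open>e l - e u\<close>, so
      \<open>h\<close> is finite almost everywhere on \<open>[l,u]\<close>.\<close>
    define k where "k r = enn2real (h r * indicator {l..u} r)" for r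
    have [measurable]: "k \<in> borel_measurable borel" unfolding k_def using h(1) by measurable
    have fin: "(\<integral>\<^sup>+r\<in>{l..u}. h r \<partial>lborel) < \<infinity>"
      using h(3)[OF lu(3,4)] lu by (auto intro: le_less_trans)
    have hk: "AE r in lborel. h r * indicator {l..u} r = ennreal (k r)"
    proof -
      have "AE r in lborel. h r * indicator {l..u} r \<noteq> \<infinity>"
        using fin h(1) by (intro nn_integral_PInf_AE) auto
      then show ?thesis
        by eventually_elim (simp add: k_def less_top)
    qed
    have k: "integrable lborel k"
    proof (rule integrableI_nonneg)
      show "(\<integral>\<^sup>+r. ennreal (k r) \<partial>lborel) < \<infinity>"
        using fin nn_integral_cong_AE[OF hk] by simp
    qed (auto simp: k_def)
    define H where "H x = (LBINT r:{..x}. k r)" for x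
    have H: "H t - H s = (LBINT r:{s..t}. k r)" if "s \<le> t" for s t
      unfolding H_def by (rule LBINT_atMost_diff[OF k that])
    have eH: "\<bar>e t - e s\<bar> \<le> \<bar>H t - H s\<bar>" if st: "l < s" "s \<le> t" "t < u" for s t
    proof -
      have "s \<in> einterval a b" "t \<in> einterval a b" using sub st by auto
      have "\<bar>E (v t) - E (v s)\<bar>
          \<le> enn2ereal (\<integral>\<^sup>+r\<in>{s..t}. (g (v r) * ennreal (metric_deriv v r)) \<partial>lborel)"
      proof -
        have "ereal l < ereal u" using lu by simp
        with sug AC have "\<forall>s t. ereal l < ereal s \<and> s \<le> t \<and> ereal t < ereal u \<longrightarrow>
           (E (v s) = \<infinity> \<and> E (v t) = \<infinity>) \<or> \<bar>E (v t) - E (v s)\<bar>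
             \<le> enn2ereal (\<integral>\<^sup>+r\<in>{s..t}. (g (v r) * ennreal (metric_deriv v r)) \<partial>lborel)"
          unfolding strong_upper_gradient_def by blast
        \<comment> \<open>The alternative of two infinite energies is excluded, since the energy
          along the flow is real.\<close>
        then show ?thesis using st eE[OF \<open>s \<in> _\<close>] by fastforce
      qed
      then have "enn2ereal (ennreal \<bar>e t - e s\<bar>)
          \<le> enn2ereal (\<integral>\<^sup>+r\<in>{s..t}. (g (v r) * ennreal (metric_deriv v r)) \<partial>lborel)"
        using eE \<open>s \<in> _\<close> \<open>t \<in> _\<close> by simp
      then have "ennreal \<bar>e t - e s\<bar> \<le> (\<integral>\<^sup>+r\<in>{s..t}. (g (v r) * ennreal (metric_deriv v r)) \<partial>lborel)"
        by (simp only: less_eq_ennreal.rep_eq)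
      also have "\<dots> \<le> (\<integral>\<^sup>+r. ennreal (indicator {s..t} r * k r) \<partial>lborel)"
      proof (rule nn_integral_mono_AE)
        show "AE r in lborel. g (v r) * ennreal (metric_deriv v r) * indicator {s..t} r
            \<le> ennreal (indicator {s..t} r * k r)"
          using gh hk
        proof eventually_elim
          case (elim r)
          show ?case
          proof (cases "r \<in> {s..t}")
            case True
            then have "r \<in> {l..u}" "r \<in> einterval a b" using st sub by auto
            then show ?thesis using elim True by simp
          qed simp
        qed
      qed
      also have "\<dots> = ennreal (LBINT r:{s..t}. k r)"
        using integrable_mult_indicator[OF _ k, of "{s..t}"]
        by (subst nn_integral_eq_integral) (auto simp: set_lebesgue_integral_def k_def)
      also have "\<dots> \<le> ennreal \<bar>H t - H s\<bar>"
        using H[OF st(2)] by (intro ennreal_leI) simp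
      finally show ?thesis by (subst (asm) ennreal_le_iff) auto
    qed
    have "(H \<longlongrightarrow> H x) (at x)"
      using isCont_LBINT_atMost[OF k, of x] by (simp add: isCont_def H_def[abs_def])
    then have "((\<lambda>y. \<bar>H y - H x\<bar>) \<longlongrightarrow> 0) (at x)"
      by (intro tendsto_rabs_zero) (simp add: LIM_zero_iff)
    moreover have "\<forall>\<^sub>F y in at x. norm (e y - e x) \<le> \<bar>H y - H x\<bar>"
    proof -
      have "\<forall>\<^sub>F y in at x. y \<in> {l<..<u}"
        using lu by (intro eventually_at_in_open') auto
      then show ?thesis
      proof eventually_elim
        case (elim y)
        then show ?case
          using eH[of x y] eH[of y x] lu by (cases "x \<le> y") (auto simp: abs_minus_commute)
      qed
    qed
    ultimately have "((\<lambda>y. e y - e x) \<longlongrightarrow> 0) (at x)"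
      by (rule Lim_null_comparison[rotated])
    then show ?thesis by (simp add: isCont_def LIM_zero_iff)
  qed
  then show ?thesis
    unfolding e_def[symmetric] by (simp add: continuous_at_imp_continuous_on)
qed

section \<open>Length of a flow under the Kurdyka-Lojasiewicz inequality\<close>

lemma rel_energy_real:
  assumes "\<bar>E w\<bar> \<noteq> \<infinity>" "\<bar>E \<phi>\<bar> \<noteq> \<infinity>"
  shows "real_of_ereal (rel_energy E \<phi> w) = real_of_ereal (E w) - real_of_ereal (E \<phi>)"
  using assms unfolding rel_energy_def by (simp add: real_of_ereal_minus)

text \<open>The density \<open>h\<close> represents the negative derivative of
  \<open>\<theta>\<close> of the relative energy. Differentiability of \<open>\<theta>\<close> at
  the current energy comes with membership of \<open>v t\<close> in \<open>U\<close>, which holds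
  for almost every \<open>t\<close>, so the chain rule applies at almost every time.\<close>

lemma gradient_flow_on_length_density:
  assumes flow: "gradient_flow_on E g a b v" and \<phi>: "\<bar>E \<phi>\<bar> \<noteq> \<infinity>" and "strict_mono \<theta>"
    and U: "AE t in lborel. t \<in> einterval a b \<longrightarrow> v t \<in> U"
    and KL: "\<And>w. w \<in> U \<Longrightarrow> \<theta> differentiable (at (real_of_ereal (rel_energy E \<phi> w))) \<and>
        1 \<le> ennreal (deriv \<theta> (real_of_ereal (rel_energy E \<phi> w))) * g w"
  obtains h :: "real \<Rightarrow> ennreal" where "h \<in> borel_measurable borel"
    "AE t in lborel. t \<in> einterval a b \<longrightarrow> ennreal (metric_deriv v t) \<le> h t"
    "\<And>s t. \<lbrakk>s \<in> einterval a b; t \<in> einterval a b; s \<le> t\<rbrakk> \<Longrightarrow> (\<integral>\<^sup>+r\<in>{s..t}. h r \<partial>lborel)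
      \<le> ennreal (\<theta> (real_of_ereal (rel_energy E \<phi> (v s))) - \<theta> (real_of_ereal (rel_energy E \<phi> (v t))))"
proof -
  define e where "e t = real_of_ereal (E (v t))" for t
  define f where "f t = \<theta> (real_of_ereal (rel_energy E \<phi> (v t)))" for t
  have re: "real_of_ereal (rel_energy E \<phi> (v t)) = e t - real_of_ereal (E \<phi>)"
    if "t \<in> einterval a b" for t
  proof -
    have "\<bar>E (v t)\<bar> \<noteq> \<infinity>" using flow that by (simp add: gradient_flow_on_def)
    then show ?thesis unfolding e_def using \<phi> by (rule rel_energy_real)
  qed
  have "f t \<le> f s" if "s \<in> einterval a b" "t \<in> einterval a b" "s \<le> t" for s t
    using gradient_flow_on_energy_antimono[OF flow that] that
    by (simp add: f_def re strict_mono_less_eq[OF \<open>strict_mono \<theta>\<close>] e_def)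
  from antimono_derivative_bound[of a b f, OF this] obtain h where h: "h \<in> borel_measurable borel"
    "\<And>x D. \<lbrakk>x \<in> einterval a b; (f has_real_derivative D) (at x)\<rbrakk> \<Longrightarrow> h x = ennreal (- D)"
    "\<And>s t. \<lbrakk>s \<in> einterval a b; t \<in> einterval a b; s \<le> t\<rbrakk>
      \<Longrightarrow> (\<integral>\<^sup>+r\<in>{s..t}. h r \<partial>lborel) \<le> ennreal (f s - f t)"
    by blast
  have "AE t in lborel. t \<in> einterval a b \<longrightarrow>
      (\<exists>D. (e has_real_derivative D) (at t) \<and> g (v t) * ennreal (metric_deriv v t) \<le> ennreal (- D))"
    using flow unfolding gradient_flow_on_def e_def by blast
  then have "AE t in lborel. t \<in> einterval a b \<longrightarrow> ennreal (metric_deriv v t) \<le> h t"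
    using U
  proof eventually_elim
    case (elim t)
    show ?case
    proof
      assume t: "t \<in> einterval a b"
      then obtain D where D: "(e has_real_derivative D) (at t)"
        "g (v t) * ennreal (metric_deriv v t) \<le> ennreal (- D)" using elim by blast
      let ?x = "e t - real_of_ereal (E \<phi>)" let ?d = "deriv \<theta> ?x"
      have "v t \<in> U" using elim t by blast
      from KL[OF this] have d: "\<theta> differentiable (at ?x)" "1 \<le> ennreal ?d * g (v t)"
        by (simp_all add: re[OF t])
      \<comment> \<open>\<open>ennreal\<close> sends a derivative that is not positive to 0, and
        then the product with \<open>g (v t)\<close> could not reach 1.\<close>
      have "?d > 0"
      proof (rule ccontr)
        assume "\<not> ?d > 0"
        then have "ennreal ?d = 0" by (simp add: ennreal_neg)
        with d(2) show False by simp
      qed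
      have "(\<theta> has_real_derivative ?d) (at ?x)"
        using d(1) by (metis DERIV_imp_deriv real_differentiable_def)
      moreover have "((\<lambda>r. e r - real_of_ereal (E \<phi>)) has_real_derivative D) (at t)"
        using D(1) by (auto intro!: derivative_eq_intros)
      ultimately have "((\<lambda>r. \<theta> (e r - real_of_ereal (E \<phi>))) has_real_derivative ?d * D) (at t)"
        by (rule DERIV_chain2)
      \<comment> \<open>\<open>f\<close> has this form only inside the interval, where the energy is
        finite; openness of the interval transfers the derivative.\<close>
      then have "(f has_real_derivative ?d * D) (at t)"
      proof (rule has_field_derivative_transform_within_open)
        show "open (einterval a b)" by simp
      qed (use t in \<open>auto simp: f_def re\<close>)
      then have "h t = ennreal (- (?d * D))" using h(2)[OF t] by blast
      also have "\<dots> = ennreal ?d * ennreal (- D)"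
        using \<open>?d > 0\<close> by (metis ennreal_mult' less_imp_le mult_minus_right)
      finally have ht: "h t = ennreal ?d * ennreal (- D)" .
      have "ennreal (metric_deriv v t) \<le> ennreal ?d * g (v t) * ennreal (metric_deriv v t)"
        using mult_right_mono[OF d(2), of "ennreal (metric_deriv v t)"] by simp
      also have "\<dots> \<le> h t"
        unfolding ht mult.assoc by (rule mult_left_mono[OF D(2)]) simp
      finally show "ennreal (metric_deriv v t) \<le> h t" .
    qed
  qed
  then show ?thesis using h(1,3) that unfolding f_def by blast
qed

lemma curve_length_le_nn_integral:
  assumes "AE t in lborel. t \<in> einterval a b \<longrightarrow> ennreal (metric_deriv v t) \<le> h t"
  shows "curve_length a b v \<le> (\<integral>\<^sup>+r\<in>einterval a b. h r \<partial>lborel)"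
  unfolding curve_length_def
  by (rule nn_integral_mono_AE) (use assms in \<open>eventually_elim, auto simp: indicator_def\<close>)

lemma curve_length_mono:
  assumes "einterval a' b' \<subseteq> einterval a b"
  shows "curve_length a' b' v \<le> curve_length a b v"
  unfolding curve_length_def by (rule nn_integral_mono) (use assms in \<open>auto simp: indicator_def\<close>)

lemma gradient_flow_on_finite:
  "gradient_flow_on E g a b v \<Longrightarrow> t \<in> einterval a b \<Longrightarrow> \<bar>E (v t)\<bar> \<noteq> \<infinity>"
  by (simp add: gradient_flow_on_def)

lemma p_gradient_flow_imp_gradient_flow_on:
  assumes "1 < p" "p_gradient_flow p E g T v"
  shows "gradient_flow_on E g 0 T v"
  using gradient_flow_on_shift[of p E g T 0 v] assms
  by (simp add: zero_ereal_def[symmetric] p_gradient_flow_def)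

text \<open>The bound is the measure of a set of values of \<open>f\<close> rather than a difference
  of end values, because for several pieces these measures add up as soon as the sets are disjoint.
  The drop of \<open>f\<close> from \<open>s\<close> to \<open>t\<close> is the length of the
  interval \<open>{f t<..<f s}\<close>, one of the members of the union.\<close>

lemma gradient_flow_on_length_density_total:
  fixes \<theta> :: "real \<Rightarrow> real"
  assumes "gradient_flow_on E g a b v" "\<bar>E \<phi>\<bar> \<noteq> \<infinity>" "strict_mono \<theta>"
    and "AE t in lborel. t \<in> einterval a b \<longrightarrow> v t \<in> U"
    and "\<And>w. w \<in> U \<Longrightarrow> \<theta> differentiable (at (real_of_ereal (rel_energy E \<phi> w))) \<and>
        1 \<le> ennreal (deriv \<theta> (real_of_ereal (rel_energy E \<phi> w))) * g w"
    and f: "\<And>t. f t = \<theta> (real_of_ereal (rel_energy E \<phi> (v t)))"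
  shows "\<exists>h. h \<in> borel_measurable borel \<and>
    (AE t in lborel. t \<in> einterval a b \<longrightarrow> ennreal (metric_deriv v t) \<le> h t) \<and>
    (\<integral>\<^sup>+r\<in>einterval a b. h r \<partial>lborel)
      \<le> emeasure lborel (\<Union>s\<in>einterval a b. \<Union>t\<in>einterval a b. {f t<..<f s})"
proof -
  let ?O = "\<Union>s\<in>einterval a b. \<Union>t\<in>einterval a b. {f t<..<f s}"
  obtain h :: "real \<Rightarrow> ennreal" where h: "h \<in> borel_measurable borel"
    "AE t in lborel. t \<in> einterval a b \<longrightarrow> ennreal (metric_deriv v t) \<le> h t"
    "\<And>s t. \<lbrakk>s \<in> einterval a b; t \<in> einterval a b; s \<le> t\<rbrakk> \<Longrightarrow> (\<integral>\<^sup>+r\<in>{s..t}. h r \<partial>lborel) \<le> ennreal (f s - f t)"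
    by (rule gradient_flow_on_length_density[OF assms(1-5), folded f]) (assumption, rule that)
  have "(\<integral>\<^sup>+r\<in>einterval a b. h r \<partial>lborel) \<le> emeasure lborel ?O"
  proof (rule nn_integral_einterval_le[OF h(1)])
    fix s t assume st: "s \<in> einterval a b" "t \<in> einterval a b" "s \<le> t"
    have "(\<integral>\<^sup>+r\<in>{s..t}. h r \<partial>lborel) \<le> ennreal (f s - f t)" by (rule h(3)[OF st])
    also have "\<dots> \<le> emeasure lborel {f t<..<f s}"
      by (cases "f t \<le> f s") (auto simp: ennreal_neg)
    also have "\<dots> \<le> emeasure lborel ?O"
    proof (rule emeasure_mono)
      show "{f t<..<f s} \<subseteq> ?O" using st by blast
      have "open ?O" by (intro open_UN ballI open_greaterThanLessThan)
      then show "?O \<in> sets lborel" by simp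
    qed
    finally show "(\<integral>\<^sup>+r\<in>{s..t}. h r \<partial>lborel) \<le> emeasure lborel ?O" .
  qed
  with h(1,2) show ?thesis by (intro exI[of _ h] conjI)
qed

section \<open>Time partitions and piecewise flows\<close>

lemma time_partition_piece:
  assumes "time_partition T \<tau>" "0 \<le> t0"
    and "x \<in> einterval (max (\<tau> i) (ereal t0)) (\<tau> (Suc i))"
  shows "t0 < x" "ereal x < T" "x \<in> piece T \<tau> i" "\<tau> i < T"
proof -
  have "\<tau> (Suc i) \<le> T"
    using assms(1) unfolding time_partition_def by (metis SUP_upper UNIV_I)
  with assms(2,3) show "t0 < x" "ereal x < T" "x \<in> piece T \<tau> i" "\<tau> i < T"
    by (auto simp: einterval_def piece_def intro: less_le_trans less_imp_le less_trans)
qed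

text \<open>The interval is found from the first index whose partition point exceeds
  \<open>x\<close>. That index is not 0, since \<open>\<tau> 0 = 0 \<le> t0 < x\<close>.\<close>

lemma time_partition_cover:
  assumes part: "time_partition T \<tau>" and "0 \<le> t0"
    and x: "x \<in> einterval (ereal t0) T" and "\<And>i. \<tau> i \<noteq> ereal x"
  obtains i where "x \<in> einterval (max (\<tau> i) (ereal t0)) (\<tau> (Suc i))"
proof -
  have "ereal x < (SUP i. \<tau> i)"
    using part x by (simp add: time_partition_def einterval_def)
  then obtain n where n: "ereal x < \<tau> n" by (auto simp: less_SUP_iff)
  have "\<not> ereal x < \<tau> 0"
    using part x \<open>0 \<le> t0\<close> by (auto simp: time_partition_def einterval_def)
  with n obtain i where "\<not> ereal x < \<tau> i" "ereal x < \<tau> (Suc i)"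
    using ex_least_nat_less[of "\<lambda>i. ereal x < \<tau> i" n] by blast
  with assms(4)[of i] x show ?thesis
    by (intro that[of i]) (auto simp: einterval_def not_less order.order_iff_strict)
qed

text \<open>The left end \<open>\<tau> i\<close> is a real number because
  \<open>0 \<le> \<tau> i < T\<close>, so it can serve as the translation in time. Cutting at
  \<open>t0\<close> is then a restriction to a subinterval.\<close>

lemma piecewise_gradient_flow_on:
  assumes "1 < p" "time_partition T \<tau>" "0 \<le> t0" "\<tau> i < T"
    and AC: "AC_loc (piece T \<tau> i) v"
    and flow: "p_gradient_flow p E g (\<tau> (Suc i) - \<tau> i) (\<lambda>r. v (real_of_ereal (\<tau> i) + r))"
  shows "gradient_flow_on E g (max (\<tau> i) (ereal t0)) (\<tau> (Suc i)) v"
proof -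
  have 0: "0 \<le> \<tau> i"
    using assms(2) unfolding time_partition_def mono_def by (metis le0)
  with \<open>\<tau> i < T\<close> obtain c where c: "\<tau> i = ereal c" "0 \<le> c"
    by (cases "\<tau> i") auto
  have "einterval (ereal c) (\<tau> (Suc i)) \<subseteq> piece T \<tau> i"
    using time_partition_piece(3)[OF assms(2) c(2), of _ i] c(1) by auto
  then have "AC_loc (einterval (ereal c) (\<tau> (Suc i))) v"
    by (rule AC_loc_subset[OF AC])
  with \<open>1 < p\<close> have "gradient_flow_on E g (ereal c) (\<tau> (Suc i)) v"
    using flow by (intro gradient_flow_on_shift) (simp_all add: c(1))
  then show ?thesis
    by (rule gradient_flow_on_subset) (auto simp: einterval_def c(1))
qed

lemma piecewise_flow_finite_length:
  fixes \<theta> :: "real \<Rightarrow> real"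
  assumes p: "1 < p" and sug: "strong_upper_gradient E g" and \<phi>: "\<bar>E \<phi>\<bar> \<noteq> \<infinity>"
    and \<theta>: "strict_mono \<theta>" "continuous_on UNIV \<theta>"
    and KL: "\<And>w. w \<in> U \<Longrightarrow> \<theta> differentiable (at (real_of_ereal (rel_energy E \<phi> w))) \<and>
        1 \<le> ennreal (deriv \<theta> (real_of_ereal (rel_energy E \<phi> w))) * g w"
    and flow: "piecewise_p_gradient_flow p E g T v" and t0: "0 \<le> t0"
    and U: "AE t in lborel. t0 \<le> t \<and> ereal t < T \<longrightarrow> v t \<in> U"
    and c: "\<And>t. t0 \<le> t \<Longrightarrow> ereal t < T \<Longrightarrow> ereal c \<le> E (v t)"
    and C: "\<And>t. t0 < t \<Longrightarrow> ereal t < T \<Longrightarrow> E (v t) \<le> ereal C"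
  shows "curve_length t0 T v < \<infinity>"
proof -
  obtain \<tau> where part: "time_partition T \<tau>"
    and pieces: "\<And>i. \<tau> i < T \<Longrightarrow> AC_loc (piece T \<tau> i) v"
      "\<And>i. \<tau> i < T \<Longrightarrow> p_gradient_flow p E g (\<tau> (Suc i) - \<tau> i) (\<lambda>r. v (real_of_ereal (\<tau> i) + r))"
    and disj: "\<And>i j x y. \<lbrakk>i \<noteq> j; \<tau> i < T; \<tau> j < T;
      {x, y} \<subseteq> (E \<circ> v) ` piece T \<tau> i \<inter> (E \<circ> v) ` piece T \<tau> j\<rbrakk> \<Longrightarrow> x = y"
    using flow unfolding piecewise_p_gradient_flow_def by metis
  define A where "A i = einterval (max (\<tau> i) (ereal t0)) (\<tau> (Suc i))" for i
  note A = time_partition_piece[OF part t0, folded A_def]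
  have A_flow: "gradient_flow_on E g (max (\<tau> i) (ereal t0)) (\<tau> (Suc i)) v" if "\<tau> i < T" for i
    by (rule piecewise_gradient_flow_on[OF p part t0 that pieces[OF that]])
  define e where "e t = real_of_ereal (E (v t))" for t
  define k where "k = real_of_ereal (E \<phi>)"
  define f where "f t = \<theta> (real_of_ereal (rel_energy E \<phi> (v t)))" for t
  have eE: "E (v t) = ereal (e t)" and fe: "f t = \<theta> (e t - k)" if "t \<in> A i" for t i
    using gradient_flow_on_finite[OF A_flow[OF A(4)[OF that]], of t] that \<phi>
    by (auto simp: A_def e_def k_def f_def rel_energy_real ereal_real)
  define S where "S i = (\<Union>s\<in>A i. \<Union>t\<in>A i. {f t<..<f s})" for i
  have open_S: "open (S i)" for i
    unfolding S_def by (intro open_UN ballI open_greaterThanLessThan)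
  \<comment> \<open>Intermediate value theorem for the continuous non-increasing function
    \<open>f\<close> on the piece. The order \<open>s \<le> t\<close> follows from
    \<open>f t < f s\<close>, as the opposite order would give \<open>f s \<le> f t\<close>.\<close>
  have ivt: "\<exists>x\<in>A i. f x = y" if "y \<in> S i" for y i
  proof -
    from that obtain s t where st: "s \<in> A i" "t \<in> A i" "f t < y" "y < f s"
      by (auto simp: S_def)
    note fl = A_flow[OF A(4)[OF st(1)]]
    have "s \<le> t"
    proof (rule ccontr)
      assume "\<not> s \<le> t"
      then have "e s \<le> e t"
        using gradient_flow_on_energy_antimono[OF fl, of t s] st by (simp add: A_def e_def)
      then have "f s \<le> f t"
        using fe st(1,2) by (simp add: strict_mono_less_eq[OF \<theta>(1)])
      with st show False by simp
    qed
    have sub: "{s..t} \<subseteq> A i"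
      using einterval_convex st(1,2) unfolding A_def by blast
    have "continuous_on (A i) (\<lambda>t. \<theta> (e t - k))"
      using gradient_flow_on_energy_continuous[OF sug fl]
      by (intro continuous_on_compose2[OF \<theta>(2)] continuous_intros) (auto simp: A_def e_def)
    then have "continuous_on (A i) f"
      by (rule continuous_on_eq) (simp add: fe)
    then have "continuous_on {s..t} f" using sub by (rule continuous_on_subset)
    from IVT2'[OF _ _ \<open>s \<le> t\<close> this, of y] st(3,4) obtain x where "s \<le> x" "x \<le> t" "f x = y"
      by auto
    then show ?thesis using sub by auto
  qed
  \<comment> \<open>An open set that contains \<open>y\<close> also contains
    \<open>y + r / 2\<close>. Both values would be attained by \<open>f\<close> on both pieces, and
    injectivity of \<open>\<theta>\<close> turns them into two different energies common to both
    images, whereas at most one is allowed.\<close>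
  have "S i \<inter> S j = {}" if "i \<noteq> j" for i j
  proof (rule ccontr)
    assume "S i \<inter> S j \<noteq> {}"
    then obtain y where y: "y \<in> S i \<inter> S j" by blast
    moreover have "open (S i \<inter> S j)" using open_S by blast
    ultimately obtain r where r: "r > 0" "ball y r \<subseteq> S i \<inter> S j"
      using open_contains_ball by blast
    then have "y + r / 2 \<in> S i \<inter> S j" by (auto simp: dist_real_def subset_iff)
    with y obtain x1 x1' x2 x2' where x: "x1 \<in> A i" "f x1 = y" "x1' \<in> A j" "f x1' = y"
      "x2 \<in> A i" "f x2 = y + r / 2" "x2' \<in> A j" "f x2' = y + r / 2"
      using ivt by (metis IntD1 IntD2)
    have inj: "E (v a) = E (v a')" if "a \<in> A i" "a' \<in> A j" "f a = f a'" for a a'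
      using that(3) by (simp add: fe[OF that(1)] fe[OF that(2)] eE[OF that(1)] eE[OF that(2)] strict_mono_eq[OF \<theta>(1)])
    have "E (v x1) = E (v x2)"
    proof (rule disj[OF \<open>i \<noteq> j\<close> A(4)[OF x(1)] A(4)[OF x(3)]])
      have "E (v x1) = E (v x1')" "E (v x2) = E (v x2')"
        using inj[of x1 x1'] inj[of x2 x2'] x by simp_all
      then show "{E (v x1), E (v x2)} \<subseteq> (E \<circ> v) ` piece T \<tau> i \<inter> (E \<circ> v) ` piece T \<tau> j"
        using A(3)[OF x(1)] A(3)[OF x(3)] A(3)[OF x(5)] A(3)[OF x(7)] by (simp add: image_iff) metis
    qed
    then have "f x1 = f x2" by (simp add: f_def rel_energy_def)
    with x r show False by simp
  qed
  then have disjS: "disjoint_family S" by (simp add: disjoint_family_on_def)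
  \<comment> \<open>The bounds \<open>c\<close> and \<open>C\<close> for the energy confine the
    values of \<open>f\<close> on all pieces to one compact interval, which bounds the total measure
    of the disjoint sets \<open>S i\<close>.\<close>
  have "S i \<subseteq> {\<theta> (c - k)..\<theta> (C - k)}" for i
  proof
    fix y assume "y \<in> S i"
    then obtain x where x: "x \<in> A i" "f x = y" using ivt by blast
    then have "c \<le> e x" "e x \<le> C"
      using c[of x] C[of x] A(1,2)[OF x(1)] eE[OF x(1)] by auto
    then show "y \<in> {\<theta> (c - k)..\<theta> (C - k)}"
      using x fe[OF x(1)] by (auto simp: strict_mono_less_eq[OF \<theta>(1)])
  qed
  then have "(\<Union>i. S i) \<subseteq> {\<theta> (c - k)..\<theta> (C - k)}" by blast
  then have "emeasure lborel (\<Union>i. S i) \<le> emeasure lborel {\<theta> (c - k)..\<theta> (C - k)}"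
    by (rule emeasure_mono) simp
  also have "\<dots> < \<infinity>" by (simp add: emeasure_lborel_Icc_eq)
  finally have fin: "(\<Sum>i. emeasure lborel (S i)) < \<infinity>"
    using suminf_emeasure[of S lborel] disjS open_S by (simp add: image_subset_iff)
  have "\<exists>h. h \<in> borel_measurable borel \<and>
      (AE t in lborel. t \<in> A i \<longrightarrow> ennreal (metric_deriv v t) \<le> h t) \<and>
      (\<integral>\<^sup>+r\<in>A i. h r \<partial>lborel) \<le> emeasure lborel (S i)" for i
  proof (cases "\<tau> i < T")
    case True
    have "AE t in lborel. t \<in> A i \<longrightarrow> v t \<in> U"
      using U by eventually_elim (use A(1,2) in \<open>auto intro: less_imp_le\<close>)
    then show ?thesis
      unfolding A_def S_def
      by (rule gradient_flow_on_length_density_total[OF A_flow[OF True] \<phi> \<theta>(1)])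
        (use KL in \<open>simp_all add: f_def\<close>)
  next
    \<comment> \<open>Indices past the end of a finite partition, where \<open>\<tau>\<close> has
      reached \<open>T\<close>.\<close>
    case False
    then have "A i = {}" using A(4) by blast
    then show ?thesis by (intro exI[of _ "\<lambda>_. 0"]) auto
  qed
  then have "\<exists>h. \<forall>i. h i \<in> borel_measurable borel \<and>
      (AE t in lborel. t \<in> A i \<longrightarrow> ennreal (metric_deriv v t) \<le> h i t) \<and>
      (\<integral>\<^sup>+r\<in>A i. h i r \<partial>lborel) \<le> emeasure lborel (S i)"
    by (intro choice allI)
  then obtain h where h: "\<And>i. h i \<in> borel_measurable borel"
    "\<And>i. AE t in lborel. t \<in> A i \<longrightarrow> ennreal (metric_deriv v t) \<le> h i t"
    "\<And>i. (\<integral>\<^sup>+r\<in>A i. h i r \<partial>lborel) \<le> emeasure lborel (S i)"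
    by auto
  have [measurable]: "A i \<in> sets borel" for i by (simp add: A_def)
  \<comment> \<open>The open pieces \<open>A i\<close> miss the partition points, which form a
    countable and hence null set. An infinite value of \<open>\<tau>\<close> contributes the point 0
    to this set.\<close>
  let ?N = "real_of_ereal ` range \<tau>"
  have "countable ?N" by simp
  then have "AE t in lborel. t \<notin> ?N"
    by (intro AE_not_in countable_imp_null_set_lborel)
  moreover have "AE t in lborel. \<forall>i. t \<in> A i \<longrightarrow> ennreal (metric_deriv v t) \<le> h i t"
    using h(2) by (simp add: AE_all_countable)
  ultimately have "AE t in lborel. t \<in> einterval (ereal t0) T \<longrightarrow>
      ennreal (metric_deriv v t) \<le> (\<Sum>i. h i t * indicator (A i) t)"
  proof eventually_elim
    case (elim t)
    show ?case
    proof
      assume t: "t \<in> einterval (ereal t0) T"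
      have "\<tau> i \<noteq> ereal t" for i using elim(1) by (metis image_eqI rangeI real_of_ereal.simps(1))
      then obtain i where i: "t \<in> A i"
        using time_partition_cover[OF part t0 t] unfolding A_def by blast
      then have "ennreal (metric_deriv v t) \<le> h i t * indicator (A i) t" using elim(2) by simp
      also have "\<dots> \<le> (\<Sum>i. h i t * indicator (A i) t)"
        using sum_le_suminf[of "\<lambda>i. h i t * indicator (A i) t" "{i}"]
        by (simp del: sum_mult_indicator sum_indicator_mult)
      finally show "ennreal (metric_deriv v t) \<le> (\<Sum>i. h i t * indicator (A i) t)" .
    qed
  qed
  then have "curve_length t0 T v
      \<le> (\<integral>\<^sup>+r\<in>einterval (ereal t0) T. (\<Sum>i. h i r * indicator (A i) r) \<partial>lborel)"
    by (rule curve_length_le_nn_integral)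
  also have "\<dots> \<le> (\<integral>\<^sup>+r. (\<Sum>i. h i r * indicator (A i) r) \<partial>lborel)"
    by (rule nn_integral_mono) (simp add: indicator_def)
  also have "\<dots> = (\<Sum>i. \<integral>\<^sup>+r\<in>A i. h i r \<partial>lborel)"
    by (rule nn_integral_suminf) (use h(1) in measurable)
  also have "\<dots> \<le> (\<Sum>i. emeasure lborel (S i))"
    by (intro suminf_le h(3)) auto
  finally show ?thesis using fin by (rule le_less_trans)
qed

section \<open>Length and distance along a single flow\<close>

lemma flow_length_le:
  fixes \<theta> :: "real \<Rightarrow> real"
  assumes p: "1 < p" and proper: "\<And>w. E w \<noteq> -\<infinity>" and \<phi>: "\<bar>E \<phi>\<bar> \<noteq> \<infinity>" and \<theta>: "strict_mono \<theta>"
    and KL: "\<And>w. w \<in> U \<Longrightarrow> \<theta> differentiable (at (real_of_ereal (rel_energy E \<phi> w))) \<and>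
        1 \<le> ennreal (deriv \<theta> (real_of_ereal (rel_energy E \<phi> w))) * g w"
    and pflow: "p_gradient_flow p E g T v" and "0 \<le> t0"
    and U: "AE t in lborel. t0 \<le> t \<and> ereal t < T \<longrightarrow> v t \<in> U"
    and st: "t0 \<le> s" "s < t" "ereal t < T" and start: "0 < s \<or> starts_regularly E T v"
  defines "f \<equiv> \<lambda>t. \<theta> (real_of_ereal (rel_energy E \<phi> (v t)))"
  shows "ennreal (dist (v s) (v t)) \<le> curve_length s t v"
    and "curve_length s t v \<le> ennreal (f s - f t)" and "f t \<le> f s"
proof -
  have f: "f x = \<theta> (real_of_ereal (rel_energy E \<phi> (v x)))" for x by (simp add: f_def)
  have flow: "gradient_flow_on E g 0 T v"
    by (rule p_gradient_flow_imp_gradient_flow_on[OF p pflow])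
  have "0 \<le> s" using \<open>0 \<le> t0\<close> st by simp
  have J: "x \<in> einterval 0 T" if "s < x" "x \<le> t" for x
    using that \<open>0 \<le> s\<close> st(3) by (auto simp: einterval_def zero_ereal_def intro: le_less_trans[of _ "ereal t"])
  have s: "s \<in> einterval 0 T" if "0 < s"
    using that st by (auto simp: einterval_def zero_ereal_def intro: less_trans[of _ "ereal t"])
  \<comment> \<open>The flow condition concerns the open interval \<open>(0,T)\<close>; for
    \<open>s = 0\<close> the comparison with the initial energy comes from
    \<open>starts_regularly\<close>.\<close>
  have Es: "E (v x) \<le> E (v s)" if "s < x" "x \<le> t" for x
  proof (cases "0 < s")
    case True
    then show ?thesis using flow s J that by (simp add: gradient_flow_on_def)
  next
    case False
    then show ?thesis using start J[OF that] \<open>0 \<le> s\<close> by (auto simp: starts_regularly_def)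
  qed
  have fin: "\<bar>E (v x)\<bar> \<noteq> \<infinity>" if "s \<le> x" "x \<le> t" for x
  proof (cases "s < x \<or> 0 < s")
    case True
    then have "x \<in> einterval 0 T" using J[of x] s that by (cases "s = x") auto
    then show ?thesis by (rule gradient_flow_on_finite[OF flow])
  next
    case False
    then have "x = 0" "starts_regularly E T v" using that \<open>0 \<le> s\<close> start by auto
    then show ?thesis using proper[of "v x"] by (auto simp: starts_regularly_def)
  qed
  have f_le: "f y \<le> f x" if "E (v y) \<le> E (v x)" "s \<le> x" "x \<le> t" "s \<le> y" "y \<le> t" for x y
  proof -
    have "real_of_ereal (E (v y)) \<le> real_of_ereal (E (v x))"
      using that(1) fin[OF that(2,3)] fin[OF that(4,5)]
      by (cases "E (v y)"; cases "E (v x)") auto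
    then show ?thesis
      using fin[OF that(2,3)] fin[OF that(4,5)] \<phi>
      by (simp add: f_def rel_energy_real strict_mono_less_eq[OF \<theta>])
  qed
  show fst: "f t \<le> f s" using Es[of t] st by (intro f_le) auto
  have st_iff: "x \<in> einterval (ereal s) (ereal t) \<longleftrightarrow> s < x \<and> x < t" for x
    by (simp add: einterval_def)
  \<comment> \<open>The density is taken on the open interval between \<open>s\<close> and
    \<open>t\<close>, so that the case \<open>s = 0\<close> is covered. The end values enter only
    through \<open>f t \<le> f y\<close> and \<open>f x \<le> f s\<close> for interior
    \<open>x\<close> and \<open>y\<close>.\<close>
  have flow': "gradient_flow_on E g (ereal s) (ereal t) v"
    by (rule gradient_flow_on_subset[OF flow]) (auto simp: st_iff intro: J)
  have U': "AE x in lborel. x \<in> einterval (ereal s) (ereal t) \<longrightarrow> v x \<in> U"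
    using U
  proof eventually_elim
    case (elim x)
    have "ereal x < T" if "x < t" using that st(3) by (auto intro: less_trans[of _ "ereal t"])
    with elim st show ?case by (auto simp: st_iff)
  qed
  obtain h where h: "h \<in> borel_measurable borel"
    "AE x in lborel. x \<in> einterval (ereal s) (ereal t) \<longrightarrow> ennreal (metric_deriv v x) \<le> h x"
    "\<And>x y. \<lbrakk>x \<in> einterval (ereal s) (ereal t); y \<in> einterval (ereal s) (ereal t); x \<le> y\<rbrakk>
      \<Longrightarrow> (\<integral>\<^sup>+r\<in>{x..y}. h r \<partial>lborel) \<le> ennreal (f x - f y)"
    by (rule gradient_flow_on_length_density[OF flow' \<phi> \<theta> U' KL, folded f]) (assumption, rule that)
  have "curve_length s t v \<le> (\<integral>\<^sup>+r\<in>einterval (ereal s) (ereal t). h r \<partial>lborel)"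
    by (rule curve_length_le_nn_integral[OF h(2)])
  also have "\<dots> \<le> ennreal (f s - f t)"
  proof (rule nn_integral_einterval_le[OF h(1)])
    fix x y assume xy: "x \<in> einterval (ereal s) (ereal t)" "y \<in> einterval (ereal s) (ereal t)" "x \<le> y"
    have "f x \<le> f s" using Es[of x] xy st by (intro f_le) (auto simp: st_iff)
    moreover have "E (v t) \<le> E (v y)"
      using flow J[of t] J[of y] xy st by (simp add: st_iff gradient_flow_on_def)
    then have "f t \<le> f y" using xy st by (intro f_le) (auto simp: st_iff)
    ultimately have "ennreal (f x - f y) \<le> ennreal (f s - f t)" by (intro ennreal_leI) simp
    with h(3)[OF xy] show "(\<integral>\<^sup>+r\<in>{x..y}. h r \<partial>lborel) \<le> ennreal (f s - f t)"
      by (rule order_trans)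
  qed
  finally show "curve_length s t v \<le> ennreal (f s - f t)" .
  show "ennreal (dist (v s) (v t)) \<le> curve_length s t v"
  proof (cases "0 < s")
    case True
    then show ?thesis using gradient_flow_on_dist_le[OF flow s J] st by simp
  next
    \<comment> \<open>For \<open>s = 0\<close> the estimate holds from every \<open>x\<close> in
      \<open>(0,t)\<close>, with a length that is at most the one from 0. Letting \<open>x\<close>
      tend to 0 uses the convergence of \<open>v\<close> to \<open>v 0\<close>.\<close>
    case False
    then have s0: "s = 0" using \<open>0 \<le> s\<close> by simp
    then have "(v \<longlongrightarrow> v s) (at_right s)" using start by (simp add: starts_regularly_def)
    then have "((\<lambda>x. ennreal (dist (v x) (v t))) \<longlongrightarrow> ennreal (dist (v s) (v t))) (at_right s)"
      by (intro tendsto_ennrealI tendsto_dist tendsto_const)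
    moreover have "\<forall>\<^sub>F x in at_right s. ennreal (dist (v x) (v t)) \<le> curve_length s t v"
      unfolding eventually_at_right_field
    proof (intro exI[of _ t] conjI allI impI)
      fix x assume x: "s < x" "x < t"
      have "ennreal (dist (v x) (v t)) \<le> curve_length (ereal x) (ereal t) v"
        using gradient_flow_on_dist_le[OF flow J J, of x t] x st by simp
      also have "\<dots> \<le> curve_length s t v"
        by (rule curve_length_mono) (use x in \<open>auto simp: einterval_def\<close>)
      finally show "ennreal (dist (v x) (v t)) \<le> curve_length s t v" .
    qed (rule st(2))
    ultimately show ?thesis by (rule tendsto_upperbound) simp
  qed
qed

lemma ereal_le_enn2ereal: "0 \<le> x \<Longrightarrow> ereal x \<le> enn2ereal y \<longleftrightarrow> ennreal x \<le> y"
  by (simp add: less_eq_ennreal.rep_eq)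

lemma enn2ereal_le_ereal: "0 \<le> x \<Longrightarrow> enn2ereal y \<le> ereal x \<longleftrightarrow> y \<le> ennreal x"
  by (simp add: less_eq_ennreal.rep_eq)

theorem theorem3p5:
  fixes E :: "'a::complete_space \<Rightarrow> ereal"
    and g :: "'a \<Rightarrow> ennreal"
    and \<phi> :: 'a and U :: "'a set" and p :: real
  assumes "1 < p"
    and "proper_energy E"
    and "strong_upper_gradient E g"
    and "g \<phi> = 0"
    and "KL_inequality E g \<phi> U"
  shows
    "(\<forall>(T::ereal) (t0::real) v.
        0 < T \<and> piecewise_p_gradient_flow p E g T v \<and>
        0 \<le> t0 \<and> ereal t0 < T \<and>
        (AE t in lborel. t0 \<le> t \<and> ereal t < T \<longrightarrow> v t \<in> U) \<and>
        (\<exists>c::real. \<forall>t. t0 \<le> t \<and> ereal t < T \<longrightarrow> ereal c \<le> E (v t)) \<and>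
        (\<exists>C::real. \<forall>t. t0 < t \<and> ereal t < T \<longrightarrow> E (v t) \<le> ereal C)
        \<longrightarrow> curve_length t0 T v < \<infinity>)
     \<and>
     (\<exists>\<theta>. strict_mono \<theta> \<and> W11_loc \<theta> \<and> \<theta> 0 = 0 \<and>
        (\<forall>(T::ereal) (t0::real) v.
           p_gradient_flow p E g T v \<and> 0 \<le> t0 \<and> ereal t0 < T \<and>
           (AE t in lborel. t0 \<le> t \<and> ereal t < T \<longrightarrow> v t \<in> U) \<longrightarrow>
           (\<forall>s t. t0 \<le> s \<and> s < t \<and> ereal t < T \<and> (0 < s \<or> starts_regularly E T v) \<longrightarrow>
              ereal (dist (v s) (v t)) \<le> enn2ereal (curve_length s t v) \<and>
              enn2ereal (curve_length s t v)
                \<le> ereal (\<theta> (real_of_ereal (rel_energy E \<phi> (v s)))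
                          - \<theta> (real_of_ereal (rel_energy E \<phi> (v t)))))))"
proof -
  have proper: "E w \<noteq> -\<infinity>" for w
    using assms(2) by (simp add: proper_energy_def)
  \<comment> \<open>A strong upper gradient is finite only on the effective domain, so the
    equilibrium has finite energy, and relative energies along a flow are real.\<close>
  have "g \<phi> < \<infinity>" using assms(4) by simp
  then have "E \<phi> < \<infinity>"
    using assms(3) by (auto simp: strong_upper_gradient_def eff_dom_def)
  then have \<phi>: "\<bar>E \<phi>\<bar> \<noteq> \<infinity>" using proper[of \<phi>] by auto
  obtain \<theta> where \<theta>: "strict_mono \<theta>" "W11_loc \<theta>" "\<theta> 0 = 0"
    and KL: "\<And>w. w \<in> U \<Longrightarrow> \<theta> differentiable (at (real_of_ereal (rel_energy E \<phi> w))) \<and>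
        1 \<le> ennreal (deriv \<theta> (real_of_ereal (rel_energy E \<phi> w))) * g w"
    using assms(5) unfolding KL_inequality_def by blast
  have cont: "continuous_on UNIV \<theta>" using \<theta>(2) by (simp add: W11_loc_def)
  show ?thesis
  proof (rule conjI, intro allI impI, elim conjE exE)
    fix T :: ereal and t0 c C :: real and v :: "real \<Rightarrow> 'a"
    assume *: "piecewise_p_gradient_flow p E g T v" "0 \<le> t0"
      "AE t in lborel. t0 \<le> t \<and> ereal t < T \<longrightarrow> v t \<in> U"
      "\<forall>t. t0 \<le> t \<and> ereal t < T \<longrightarrow> ereal c \<le> E (v t)"
      "\<forall>t. t0 < t \<and> ereal t < T \<longrightarrow> E (v t) \<le> ereal C"
    show "curve_length (ereal t0) T v < \<infinity>"
      by (rule piecewise_flow_finite_length[OF assms(1,3) \<phi> \<theta>(1) cont KL *(1-3)])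
        (use *(4,5) in auto)
  next
    show "\<exists>\<theta>. strict_mono \<theta> \<and> W11_loc \<theta> \<and> \<theta> 0 = 0 \<and>
        (\<forall>(T::ereal) (t0::real) v.
           p_gradient_flow p E g T v \<and> 0 \<le> t0 \<and> ereal t0 < T \<and>
           (AE t in lborel. t0 \<le> t \<and> ereal t < T \<longrightarrow> v t \<in> U) \<longrightarrow>
           (\<forall>s t. t0 \<le> s \<and> s < t \<and> ereal t < T \<and> (0 < s \<or> starts_regularly E T v) \<longrightarrow>
              ereal (dist (v s) (v t)) \<le> enn2ereal (curve_length s t v) \<and>
              enn2ereal (curve_length s t v)
                \<le> ereal (\<theta> (real_of_ereal (rel_energy E \<phi> (v s)))
                          - \<theta> (real_of_ereal (rel_energy E \<phi> (v t))))))"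
    \<comment> \<open>The function from the Kurdyka-Lojasiewicz inequality is itself the witness; it
      depends neither on the flow nor on \<open>T\<close> and \<open>t0\<close>.\<close>
    proof (intro exI[of _ \<theta>] conjI \<theta> allI impI; elim conjE)
      fix T :: ereal and t0 s t :: real and v :: "real \<Rightarrow> 'a"
      assume *: "p_gradient_flow p E g T v" "0 \<le> t0"
        "AE t in lborel. t0 \<le> t \<and> ereal t < T \<longrightarrow> v t \<in> U"
        "t0 \<le> s" "s < t" "ereal t < T" "0 < s \<or> starts_regularly E T v"
      note le = flow_length_le[OF assms(1) proper \<phi> \<theta>(1) KL *]
      show "ereal (dist (v s) (v t)) \<le> enn2ereal (curve_length s t v)"
        using le(1) by (simp add: ereal_le_enn2ereal)
      \<comment> \<open>\<open>ennreal\<close> truncates negative numbers to 0, so the bound passes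
        to \<open>ereal\<close> because the difference of the two values of \<open>\<theta>\<close>
        is nonnegative.\<close>
      show "enn2ereal (curve_length s t v)
          \<le> ereal (\<theta> (real_of_ereal (rel_energy E \<phi> (v s))) - \<theta> (real_of_ereal (rel_energy E \<phi> (v t))))"
        using le(2,3) by (simp add: enn2ereal_le_ereal)
    qed
  qed
qed

end
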